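(* Let $N$ be a (zero-delayed) renewal process whose interarrival times satisfy $\mathbb{E}[\tau_1^s]=\int_0^\infty x^s\,F(dx)<\infty$ for some $s\ge 1$. Let $A_t$ and $B_t$ be its backward and forward recurrence times. Then, for any $p$ with $0<p\le s$, the convergence in distribution $$\left(\frac{1}{T^{1/p}}\left(A_{Tv},B_{Tv}\right)\right)_{v\in[0,1]}\ \longrightarrow\ (0,0)\qquad (T\to\infty)$$ holds in the Skorokhod topology on the space of $\mathbb{R}^2$-valued c\`adl\`ag functions on $[0,1]$, where the limit is the identically zero function.
   Context: $\tau_1,\tau_2,\dots$ are i.i.d. random variables with values in $(0,\infty)$ and distribution function $F(x)=\mathbb{P}(\tau_1\le x)$. Put $S_0=0$ and $S_n=\tau_1+\dots+\tau_n$ for $n\ge 1$. The zero-delayed renewal process is $N(t)=\sum_{n\ge 0}1_{\{S_n\le t\}}$, $t\ge 0$ (the renewal at time $0$ is counted, so $N(0)=1$). The backward and forward recurrence times are $$A_t=t-S_{N(t)-1},\qquad B_t=S_{N(t)}-t,\qquad t\ge 0.$$ *)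

theory Defs
  imports "HOL-Probability.Probability"
begin

section \<open>The Skorokhod space of cadlag functions on the unit interval\<close>

text \<open>Only the values of \<open>x\<close> on \<open>[0,1]\<close> matter: right limits are taken at \<open>t < 1\<close> and left limits
  at \<open>t > 0\<close>, which involve only points of the interval.\<close>

definition cadlag :: "(real \<Rightarrow> 'a::metric_space) \<Rightarrow> bool" where
  "cadlag x \<longleftrightarrow>
     (\<forall>t\<in>{0..<1}. (x \<longlongrightarrow> x t) (at_right t)) \<and>
     (\<forall>t\<in>{0<..1}. \<exists>l. (x \<longlongrightarrow> l) (at_left t))"

lemma cadlag_cong:
  assumes "\<And>t. t \<in> {0..1} \<Longrightarrow> x t = y t"
  shows "cadlag x \<longleftrightarrow> cadlag y"
proof -
  have R: "(x \<longlongrightarrow> x t) (at_right t) \<longleftrightarrow> (y \<longlongrightarrow> y t) (at_right t)" if "t \<in> {0..<1}" for t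
  proof -
    have "eventually (\<lambda>u. u \<in> {t<..<1}) (at_right t)"
      using that by (intro eventually_at_right_real) auto
    then have "eventually (\<lambda>u. x u = y u) (at_right t)"
      by eventually_elim (use assms that in auto)
    moreover have "x t = y t" using assms that by auto
    ultimately show ?thesis using tendsto_cong by metis
  qed
  have L: "(x \<longlongrightarrow> l) (at_left t) \<longleftrightarrow> (y \<longlongrightarrow> l) (at_left t)" if "t \<in> {0<..1}" for t l
  proof -
    have "eventually (\<lambda>u. u \<in> {0<..<t}) (at_left t)"
      using that by (intro eventually_at_left_real) auto
    then have "eventually (\<lambda>u. x u = y u) (at_left t)"
      by eventually_elim (use assms that in auto)
    then show ?thesis by (rule tendsto_cong)
  qed
  show ?thesis unfolding cadlag_def using R L by simp
qed

typedef (overloaded) 'a skorokhod =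
  "{x :: real \<Rightarrow> 'a::metric_space. cadlag x \<and> x \<in> extensional {0..1}}"
proof -
  have "cadlag (\<lambda>t\<in>{0..1}. c)" for c :: 'a
    by (subst cadlag_cong[where y = "\<lambda>_. c"]) (auto simp: cadlag_def)
  then show ?thesis by (metis (mono_tags, lifting) mem_Collect_eq restrict_extensional)
qed

definition skorokhod_of :: "(real \<Rightarrow> 'a::metric_space) \<Rightarrow> 'a skorokhod" where
  "skorokhod_of x = Abs_skorokhod (restrict x {0..1})"

lemma Rep_skorokhod_of:
  assumes "cadlag x"
  shows "Rep_skorokhod (skorokhod_of x) = restrict x {0..1}"
proof -
  have "cadlag (restrict x {0..1})"
    using assms by (subst cadlag_cong[where y = x]) auto
  then show ?thesis by (simp add: skorokhod_of_def Abs_skorokhod_inverse)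
qed

definition time_changes :: "(real \<Rightarrow> real) set" where
  "time_changes = {\<mu>. strict_mono_on {0..1} \<mu> \<and> continuous_on {0..1} \<mu> \<and> \<mu> ` {0..1} = {0..1}}"

definition skorokhod_close :: "real \<Rightarrow> (real \<Rightarrow> 'a::metric_space) \<Rightarrow> (real \<Rightarrow> 'a) \<Rightarrow> bool" where
  "skorokhod_close e x y \<longleftrightarrow>
     (\<exists>\<mu>\<in>time_changes. \<forall>t\<in>{0..1}. \<bar>\<mu> t - t\<bar> \<le> e \<and> dist (x t) (y (\<mu> t)) \<le> e)"

lemma time_changes_id: "(\<lambda>t. t) \<in> time_changes"
  by (auto simp: time_changes_def strict_mono_on_def)

lemma time_changes_comp:
  assumes "\<mu> \<in> time_changes" "\<nu> \<in> time_changes"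
  shows "(\<lambda>t. \<nu> (\<mu> t)) \<in> time_changes"
proof -
  have m: "\<mu> ` {0..1} = {0..1}" and n: "\<nu> ` {0..1} = {0..1}"
    using assms by (auto simp: time_changes_def)
  have "strict_mono_on {0..1} (\<lambda>t. \<nu> (\<mu> t))"
    using assms m unfolding time_changes_def strict_mono_on_def by blast
  moreover have "continuous_on {0..1} (\<lambda>t. \<nu> (\<mu> t))"
    using assms by (intro continuous_on_compose2[where f = \<mu> and g = \<nu> and t = "{0..1}"]) (auto simp: time_changes_def)
  moreover have "(\<lambda>t. \<nu> (\<mu> t)) ` {0..1} = {0..1}"
    using m n by (metis image_image)
  ultimately show ?thesis by (simp add: time_changes_def)
qed

lemma time_changes_inverse:
  assumes "\<mu> \<in> time_changes"
  obtains \<nu> where "\<nu> \<in> time_changes"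
    "\<And>t. t \<in> {0..1} \<Longrightarrow> \<nu> t \<in> {0..1} \<and> \<mu> (\<nu> t) = t"
proof -
  define \<nu> where "\<nu> = the_inv_into {0..1} \<mu>"
  have sm: "strict_mono_on {0..1} \<mu>" and im: "\<mu> ` {0..1} = {0..1}" and c: "continuous_on {0..1} \<mu>"
    using assms by (auto simp: time_changes_def)
  have inj: "inj_on \<mu> {0..1}" using sm by (rule strict_mono_on_imp_inj_on)
  have nm: "\<nu> (\<mu> t) = t" if "t \<in> {0..1}" for t
    unfolding \<nu>_def using inj that by (rule the_inv_into_f_f)
  have mn: "\<nu> t \<in> {0..1} \<and> \<mu> (\<nu> t) = t" if t: "t \<in> {0..1}" for t
  proof -
    obtain u where u: "u \<in> {0..1}" "t = \<mu> u" using t im by (metis imageE)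
    then show ?thesis using nm by simp
  qed
  have "continuous_on (\<mu> ` {0..1}) \<nu>"
    using c nm by (intro continuous_on_inv) auto
  moreover have "\<nu> ` {0..1} = {0..1}"
  proof
    show "\<nu> ` {0..1} \<subseteq> {0..1}" using mn by auto
    show "{0..1} \<subseteq> \<nu> ` {0..1}" using nm im by (metis image_eqI subsetI)
  qed
  moreover have "strict_mono_on {0..1} \<nu>"
  proof (rule strict_mono_onI)
    fix r t :: real assume rt: "r \<in> {0..1}" "t \<in> {0..1}" "r < t"
    show "\<nu> r < \<nu> t"
    proof (rule ccontr)
      assume "\<not> \<nu> r < \<nu> t"
      then have "\<nu> t \<le> \<nu> r" by simp
      then have "\<mu> (\<nu> t) \<le> \<mu> (\<nu> r)"
        using sm mn rt by (metis strict_mono_on_leD)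
      then show False using mn rt by auto
    qed
  qed
  ultimately have "\<nu> \<in> time_changes" using im by (simp add: time_changes_def)
  then show ?thesis using mn that by blast
qed

lemma time_changes_one:
  assumes "\<mu> \<in> time_changes"
  shows "\<mu> 1 = 1"
proof -
  have sm: "strict_mono_on {0..1} \<mu>" and im: "\<mu> ` {0..1} = {0..1}"
    using assms by (auto simp: time_changes_def)
  have "1 \<in> \<mu> ` {0..1}" using im by simp
  then obtain u where u: "u \<in> {0..1}" "\<mu> u = 1" by force
  have "\<mu> u \<le> \<mu> 1" using sm u by (intro strict_mono_on_leD[OF sm]) auto
  moreover have "\<mu> 1 \<in> {0..1}" using im by (metis atLeastAtMost_iff image_eqI order_refl zero_le_one)
  ultimately show ?thesis using u by auto
qed

lemma skorokhod_close_refl: "0 \<le> e \<Longrightarrow> skorokhod_close e x x"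
  unfolding skorokhod_close_def by (rule bexI[OF _ time_changes_id]) auto

lemma skorokhod_close_mono: "skorokhod_close e x y \<Longrightarrow> e \<le> e' \<Longrightarrow> skorokhod_close e' x y"
  unfolding skorokhod_close_def by (meson order_trans)

lemma skorokhod_close_sym:
  assumes "skorokhod_close e x y"
  shows "skorokhod_close e y x"
proof -
  obtain \<mu> where m: "\<mu> \<in> time_changes"
    "\<And>t. t \<in> {0..1} \<Longrightarrow> \<bar>\<mu> t - t\<bar> \<le> e \<and> dist (x t) (y (\<mu> t)) \<le> e"
    using assms unfolding skorokhod_close_def by blast
  obtain \<nu> where n: "\<nu> \<in> time_changes"
    "\<And>t. t \<in> {0..1} \<Longrightarrow> \<nu> t \<in> {0..1} \<and> \<mu> (\<nu> t) = t"
    using time_changes_inverse[OF m(1)] by blast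
  have "\<bar>\<nu> t - t\<bar> \<le> e \<and> dist (y t) (x (\<nu> t)) \<le> e" if "t \<in> {0..1}" for t
    using m(2)[of "\<nu> t"] n(2)[OF that] by (auto simp: dist_commute abs_minus_commute)
  then show ?thesis unfolding skorokhod_close_def using n(1) by blast
qed

lemma skorokhod_close_trans:
  assumes "skorokhod_close d x y" "skorokhod_close e y z"
  shows "skorokhod_close (d + e) x z"
proof -
  obtain \<mu> where m: "\<mu> \<in> time_changes"
    "\<And>t. t \<in> {0..1} \<Longrightarrow> \<bar>\<mu> t - t\<bar> \<le> d \<and> dist (x t) (y (\<mu> t)) \<le> d"
    using assms unfolding skorokhod_close_def by blast
  obtain \<nu> where n: "\<nu> \<in> time_changes"
    "\<And>t. t \<in> {0..1} \<Longrightarrow> \<bar>\<nu> t - t\<bar> \<le> e \<and> dist (y t) (z (\<nu> t)) \<le> e"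
    using assms unfolding skorokhod_close_def by blast
  have "\<bar>\<nu> (\<mu> t) - t\<bar> \<le> d + e \<and> dist (x t) (z (\<nu> (\<mu> t))) \<le> d + e" if t: "t \<in> {0..1}" for t
  proof -
    have mt: "\<mu> t \<in> {0..1}" using m(1) t unfolding time_changes_def by blast
    have "dist (x t) (z (\<nu> (\<mu> t))) \<le> dist (x t) (y (\<mu> t)) + dist (y (\<mu> t)) (z (\<nu> (\<mu> t)))"
      by (rule dist_triangle)
    then show ?thesis using m(2)[OF t] n(2)[OF mt] by linarith
  qed
  then show ?thesis unfolding skorokhod_close_def
    by (intro bexI[OF _ time_changes_comp[OF m(1) n(1)]]) simp
qed

lemma cadlag_bounded:
  assumes "cadlag x"
  shows "bounded (x ` {0..1})"
proof -
  have "bounded (x ` ({0..1} \<inter> {0..1}))"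
  proof (rule Bolzano[where a = 0 and b = 1 and P = "\<lambda>a b. bounded (x ` ({a..b} \<inter> {0..1}))"])
    show "(0::real) \<le> 1" by simp
  next
    fix a b c :: real
    assume P: "bounded (x ` ({a..b} \<inter> {0..1}))" "bounded (x ` ({b..c} \<inter> {0..1}))"
      and "a \<le> b" "b \<le> c"
    then have "{a..c} \<inter> {0..1} = ({a..b} \<inter> {0..1}) \<union> ({b..c} \<inter> {0..1})" by auto
    then have "x ` ({a..c} \<inter> {0..1}) = x ` ({a..b} \<inter> {0..1}) \<union> x ` ({b..c} \<inter> {0..1})"
      by (simp only: image_Un)
    then show "bounded (x ` ({a..c} \<inter> {0..1}))" using P by (simp only: bounded_Un)
  next
    fix t :: real assume local: "0 \<le> t" "t \<le> 1"
    have "\<exists>b>t. bounded (x ` ({t..<b} \<inter> {0..1}))"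
    proof (cases "t < 1")
      case True
      then have "(x \<longlongrightarrow> x t) (at_right t)" using assms local by (auto simp: cadlag_def)
      then have "eventually (\<lambda>u. dist (x u) (x t) < 1) (at_right t)" by (rule tendstoD) simp
      then obtain b where b: "b > t" "\<And>u. t < u \<Longrightarrow> u < b \<Longrightarrow> dist (x u) (x t) < 1"
        unfolding eventually_at_right_field by blast
      have "x ` ({t..<b} \<inter> {0..1}) \<subseteq> cball (x t) 1"
      proof (clarsimp)
        fix u assume "t \<le> u" "u < b"
        then show "dist (x t) (x u) \<le> 1" using b(2)[of u] by (cases "u = t") (auto simp: dist_commute)
      qed
      then show ?thesis using b(1) by (meson bounded_cball bounded_subset)
    next
      case False
      then have "{t..<t+1} \<inter> {0..1} \<subseteq> {t}" by auto
      then have "bounded (x ` ({t..<t+1} \<inter> {0..1}))"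
        by (meson finite.emptyI finite.insertI finite_imageI finite_imp_bounded finite_subset)
      then show ?thesis by (intro exI[of _ "t+1"]) auto
    qed
    then obtain b where b: "b > t" "bounded (x ` ({t..<b} \<inter> {0..1}))" by blast
    have "\<exists>a<t. bounded (x ` ({a<..<t} \<inter> {0..1}))"
    proof (cases "t > 0")
      case True
      then have "t \<in> {0<..1}" using local by simp
      then obtain l where "(x \<longlongrightarrow> l) (at_left t)" using assms unfolding cadlag_def by blast
      then have "eventually (\<lambda>u. dist (x u) l < 1) (at_left t)" by (rule tendstoD) simp
      then obtain a where a: "a < t" "\<And>u. a < u \<Longrightarrow> u < t \<Longrightarrow> dist (x u) l < 1"
        unfolding eventually_at_left_field by blast
      have "x ` ({a<..<t} \<inter> {0..1}) \<subseteq> cball l 1"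
        using a(2) by (force simp: dist_commute)
      then show ?thesis using a(1) by (meson bounded_cball bounded_subset)
    next
      case False
      then have "{t-1<..<t} \<inter> {0..1} = {}" by auto
      then show ?thesis by (intro exI[of _ "t-1"]) (simp add: image_def)
    qed
    then obtain a where a: "a < t" "bounded (x ` ({a<..<t} \<inter> {0..1}))" by blast
    show "\<exists>d>0. \<forall>a b. a \<le> t \<and> t \<le> b \<and> b - a < d \<longrightarrow> bounded (x ` ({a..b} \<inter> {0..1}))"
    proof (intro exI[of _ "min (t - a) (b - t)"] conjI allI impI)
      show "0 < min (t - a) (b - t)" using a b by auto
      fix c d assume cd: "c \<le> t \<and> t \<le> d \<and> d - c < min (t - a) (b - t)"
      then have "{c..d} \<inter> {0..1} \<subseteq> ({a<..<t} \<inter> {0..1}) \<union> ({t..<b} \<inter> {0..1})" by auto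
      then have "x ` ({c..d} \<inter> {0..1}) \<subseteq> x ` ({a<..<t} \<inter> {0..1}) \<union> x ` ({t..<b} \<inter> {0..1})" by blast
      then show "bounded (x ` ({c..d} \<inter> {0..1}))" using a b by (meson bounded_Un bounded_subset)
    qed
  qed
  then show ?thesis by simp
qed

lemma skorokhod_close_ex:
  assumes "cadlag x" "cadlag y"
  shows "\<exists>e>0. skorokhod_close e x y"
proof -
  have "bounded (x ` {0..1} \<union> y ` {0..1})"
    using assms by (simp add: cadlag_bounded)
  then obtain e where e: "\<And>a b. a \<in> x ` {0..1} \<union> y ` {0..1} \<Longrightarrow> b \<in> x ` {0..1} \<union> y ` {0..1} \<Longrightarrow> dist a b \<le> e"
    unfolding bounded_two_points by blast
  have "skorokhod_close (max e 1) x y"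
    unfolding skorokhod_close_def
    by (rule bexI[OF _ time_changes_id]) (auto intro!: e le_max_iff_disj[THEN iffD2])
  then show ?thesis by (intro exI[of _ "max e 1"]) auto
qed

lemma skorokhod_close_all_eq:
  assumes x: "cadlag x" and y: "cadlag y"
    and close: "\<And>e. 0 < e \<Longrightarrow> skorokhod_close e x y" and t: "t \<in> {0..1}"
  shows "x t = y t"
proof (cases "t = 1")
  case True
  have "dist (x 1) (y 1) \<le> e" if "0 < e" for e
    using close[OF that] time_changes_one unfolding skorokhod_close_def
    by (metis atLeastAtMost_iff order_refl zero_le_one)
  then have "dist (x 1) (y 1) \<le> 0" by (rule field_le_epsilon) auto
  then show ?thesis using True by simp
next
  case False
  then have t: "t \<in> {0..<1}" using t by auto
  have "dist (x t) (y t) \<le> 0 + e" if e: "0 < e" for e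
  proof -
    have "eventually (\<lambda>u. dist (x u) (x t) < e/3) (at_right t)"
      using x t e by (intro tendstoD) (auto simp: cadlag_def)
    moreover have "eventually (\<lambda>u. dist (y u) (y t) < e/3) (at_right t)"
      using y t e by (intro tendstoD) (auto simp: cadlag_def)
    ultimately have "eventually (\<lambda>u. dist (x u) (x t) < e/3 \<and> dist (y u) (y t) < e/3) (at_right t)"
      by (rule eventually_conj)
    then obtain b where b: "b > t"
      "\<And>u. t < u \<Longrightarrow> u < b \<Longrightarrow> dist (x u) (x t) < e/3 \<and> dist (y u) (y t) < e/3"
      unfolding eventually_at_right_field by blast
    define d where "d = min b 1 - t"
    have d: "0 < d" "t + d \<le> b" "t + d \<le> 1" using b(1) t by (auto simp: d_def)
    define r where "r = min (e/3) (d/4)"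
    have r: "0 < r" "r \<le> e/3" "r \<le> d/4" using d e by (auto simp: r_def)
    define u where "u = t + d/2"
    have u: "u \<in> {0..1}" "t < u" "u < b" using d t by (auto simp: u_def)
    obtain \<mu> where "\<bar>\<mu> u - u\<bar> \<le> r" "dist (x u) (y (\<mu> u)) \<le> r"
      using close[OF r(1)] u(1) unfolding skorokhod_close_def by blast
    moreover from this have "t < \<mu> u" "\<mu> u < b" using r d unfolding u_def by linarith+
    moreover have "dist (x t) (y t) \<le> dist (x u) (x t) + dist (x u) (y (\<mu> u)) + dist (y (\<mu> u)) (y t)"
      using dist_triangle[of "x t" "y t" "x u"] dist_triangle[of "x u" "y t" "y (\<mu> u)"]
      by (simp add: dist_commute)
    ultimately show ?thesis using b(2)[of u] b(2)[of "\<mu> u"] u r by fastforce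
  qed
  then have "dist (x t) (y t) \<le> 0" by (rule field_le_epsilon)
  then show ?thesis by simp
qed

text \<open>Billingsley's metric for the (J1) Skorokhod topology; the topology of the type, and hence
  \<^term>\<open>borel\<close> and continuity on it, are the ones induced by this metric.\<close>

instantiation skorokhod :: (metric_space) metric_space
begin

definition dist_skorokhod :: "'a skorokhod \<Rightarrow> 'a skorokhod \<Rightarrow> real" where
  "dist_skorokhod x y = Inf {e. 0 < e \<and> skorokhod_close e (Rep_skorokhod x) (Rep_skorokhod y)}"

definition uniformity_skorokhod :: "('a skorokhod \<times> 'a skorokhod) filter" where
  "uniformity_skorokhod = (INF e\<in>{0<..}. principal {(x, y). dist x y < e})"

definition open_skorokhod :: "'a skorokhod set \<Rightarrow> bool" where
  "open_skorokhod U \<longleftrightarrow> (\<forall>x\<in>U. eventually (\<lambda>(x', y). x' = x \<longrightarrow> y \<in> U) uniformity)"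

instance
proof
  have nonempty: "{e. 0 < e \<and> skorokhod_close e (Rep_skorokhod x) (Rep_skorokhod y)} \<noteq> {}"
    for x y :: "'a skorokhod"
    using skorokhod_close_ex[of "Rep_skorokhod x" "Rep_skorokhod y"] Rep_skorokhod by blast
  have bdd: "bdd_below {e. 0 < e \<and> skorokhod_close e (Rep_skorokhod x) (Rep_skorokhod y)}"
    for x y :: "'a skorokhod"
    by (rule bdd_belowI[of _ 0]) auto
  have nonneg: "0 \<le> dist x y" for x y :: "'a skorokhod"
    unfolding dist_skorokhod_def using nonempty by (intro cInf_greatest) auto
  have le: "dist x y \<le> e" if "0 < e" "skorokhod_close e (Rep_skorokhod x) (Rep_skorokhod y)"
    for x y :: "'a skorokhod" and e
    unfolding dist_skorokhod_def using that bdd by (intro cInf_lower) auto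
  have closeI: "skorokhod_close e (Rep_skorokhod x) (Rep_skorokhod y)" if lt: "dist x y < e"
    for x y :: "'a skorokhod" and e
  proof -
    from lt obtain e' where "e' < e" "skorokhod_close e' (Rep_skorokhod x) (Rep_skorokhod y)"
      unfolding dist_skorokhod_def using cInf_lessD[OF nonempty] by blast
    then show ?thesis using skorokhod_close_mono by (metis less_imp_le)
  qed
  show "dist x y = 0 \<longleftrightarrow> x = y" for x y :: "'a skorokhod"
  proof
    assume eq: "dist x y = 0"
    have "Rep_skorokhod x t = Rep_skorokhod y t" for t
    proof (cases "t \<in> {0..1}")
      case True
      show ?thesis
        using Rep_skorokhod[of x] Rep_skorokhod[of y] True
        by (intro skorokhod_close_all_eq) (auto intro!: closeI simp: eq)
    next
      case False
      then show ?thesis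
        using Rep_skorokhod[of x] Rep_skorokhod[of y] by (simp add: extensional_def)
    qed
    then show "x = y" by (metis Rep_skorokhod_inject ext)
  next
    assume "x = y"
    then have "dist x y \<le> 0 + e" if "0 < e" for e
      using that by (auto intro!: le skorokhod_close_refl)
    then have "dist x y \<le> 0" by (rule field_le_epsilon)
    then show "dist x y = 0" using nonneg[of x y] by simp
  qed
  show "dist x y \<le> dist x z + dist y z" for x y z :: "'a skorokhod"
  proof (rule field_le_epsilon)
    fix e :: real assume e: "0 < e"
    have "skorokhod_close (dist x z + e/2) (Rep_skorokhod x) (Rep_skorokhod z)"
      using e by (intro closeI) auto
    moreover have "skorokhod_close (dist y z + e/2) (Rep_skorokhod z) (Rep_skorokhod y)"
      using e by (intro skorokhod_close_sym[OF closeI]) auto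
    ultimately have "skorokhod_close ((dist x z + e/2) + (dist y z + e/2)) (Rep_skorokhod x) (Rep_skorokhod y)"
      by (rule skorokhod_close_trans)
    then have "dist x y \<le> (dist x z + e/2) + (dist y z + e/2)"
      using e nonneg[of x z] nonneg[of y z] by (intro le) auto
    then show "dist x y \<le> dist x z + dist y z + e" by simp
  qed
qed (rule uniformity_skorokhod_def open_skorokhod_def)+

end

section \<open>Convergence in distribution\<close>

text \<open>Random elements of a metric space are the Borel measurable maps. Measurability of
  \<open>X i\<close> is only asked for eventually, since for a family indexed by the reals with \<open>i \<rightarrow> \<infinity>\<close> the
  members with \<open>i \<le> 0\<close> need not be meaningful.\<close>

definition converges_in_distribution ::
    "'a measure \<Rightarrow> ('i \<Rightarrow> 'a \<Rightarrow> 'b::metric_space) \<Rightarrow> ('a \<Rightarrow> 'b) \<Rightarrow> 'i filter \<Rightarrow> bool" where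
  "converges_in_distribution M X Y F \<longleftrightarrow>
     (\<forall>\<^sub>F i in F. X i \<in> borel_measurable M) \<and> Y \<in> borel_measurable M \<and>
     (\<forall>f :: 'b \<Rightarrow> real. continuous_on UNIV f \<longrightarrow> bounded (range f) \<longrightarrow>
        ((\<lambda>i. \<integral>\<omega>. f (X i \<omega>) \<partial>M) \<longlongrightarrow> (\<integral>\<omega>. f (Y \<omega>) \<partial>M)) F)"

section \<open>Renewal processes\<close>

text \<open>The interarrival times are \<open>\<tau> 1, \<tau> 2, \<dots>\<close>; \<open>\<tau> 0\<close> is not used.\<close>

definition arrival :: "(nat \<Rightarrow> 'a \<Rightarrow> real) \<Rightarrow> nat \<Rightarrow> 'a \<Rightarrow> real" where
  "arrival \<tau> n \<omega> = (\<Sum>i=1..n. \<tau> i \<omega>)"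

text \<open>The count includes the renewal at time 0. On the null event where infinitely many renewals
  occur before \<open>t\<close>, \<^const>\<open>card\<close> returns 0; the paths below are cadlag even then.\<close>

definition renewal_count :: "(nat \<Rightarrow> 'a \<Rightarrow> real) \<Rightarrow> real \<Rightarrow> 'a \<Rightarrow> nat" where
  "renewal_count \<tau> t \<omega> = card {n. arrival \<tau> n \<omega> \<le> t}"

definition backward_recurrence :: "(nat \<Rightarrow> 'a \<Rightarrow> real) \<Rightarrow> real \<Rightarrow> 'a \<Rightarrow> real" where
  "backward_recurrence \<tau> t \<omega> = t - arrival \<tau> (renewal_count \<tau> t \<omega> - 1) \<omega>"

definition forward_recurrence :: "(nat \<Rightarrow> 'a \<Rightarrow> real) \<Rightarrow> real \<Rightarrow> 'a \<Rightarrow> real" where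
  "forward_recurrence \<tau> t \<omega> = arrival \<tau> (renewal_count \<tau> t \<omega>) \<omega> - t"

definition scaled_recurrence_path ::
    "(nat \<Rightarrow> 'a \<Rightarrow> real) \<Rightarrow> real \<Rightarrow> real \<Rightarrow> 'a \<Rightarrow> real \<Rightarrow> real \<times> real" where
  "scaled_recurrence_path \<tau> p T \<omega> v =
     (1 / T powr (1 / p)) *\<^sub>R (backward_recurrence \<tau> (T * v) \<omega>, forward_recurrence \<tau> (T * v) \<omega>)"

text \<open>The paths are elements of the Skorokhod space, so \<^const>\<open>skorokhod_of\<close> is applied to them
  within its intended domain.\<close>

lemma cadlag_scaled_recurrence_path:
  assumes pos: "\<And>n. 1 \<le> n \<Longrightarrow> 0 < \<tau> n \<omega>" and T: "0 < T"
  shows "cadlag (scaled_recurrence_path \<tau> p T \<omega>)"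
proof -
  define S where "S n = arrival \<tau> n \<omega>" for n
  define A where "A t = backward_recurrence \<tau> t \<omega>" for t
  define B where "B t = forward_recurrence \<tau> t \<omega>" for t
  have S0: "S 0 = 0" by (simp add: S_def arrival_def)
  have "S n < S (Suc n)" for n using pos[of "Suc n"] by (simp add: S_def arrival_def)
  then have "strict_mono S" by (rule strict_monoI_Suc)
  then have Sle: "S m \<le> S n \<longleftrightarrow> m \<le> n" for m n by (rule strict_mono_less_eq)
  have AB: "A t = t - S k" "B t = S (Suc k) - t" if "S k \<le> t" "t < S (Suc k)" for t k
  proof -
    have "{n. S n \<le> t} = {..k}"
      using that Sle by (auto; metis not_less_eq_eq order_less_le_trans order_trans leD)
    then have "renewal_count \<tau> t \<omega> = Suc k" by (simp add: renewal_count_def S_def)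
    then show "A t = t - S k" "B t = S (Suc k) - t"
      by (simp_all add: A_def B_def backward_recurrence_def forward_recurrence_def S_def)
  qed
  have AB_inf: "A t = t" "B t = - t" if "\<And>n. S n \<le> t" for t
  proof -
    have "renewal_count \<tau> t \<omega> = 0" using that by (simp add: renewal_count_def S_def)
    then show "A t = t" "B t = - t"
      by (simp_all add: A_def B_def backward_recurrence_def forward_recurrence_def arrival_def)
  qed
  have step: "(\<exists>k. P k \<and> \<not> P (Suc k)) \<or> (\<forall>k. P k)" if "P 0" for P
    using that by (metis nat_induct)
  have right: "((\<lambda>u. (A u, B u)) \<longlongrightarrow> (A t, B t)) (at_right t)" if t: "0 \<le> t" for t
  proof -
    have "(\<exists>k. S k \<le> t \<and> \<not> S (Suc k) \<le> t) \<or> (\<forall>k. S k \<le> t)"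
      using step[of "\<lambda>k. S k \<le> t"] S0 t by simp
    then show ?thesis
    proof (elim disjE exE conjE)
      fix k assume k: "S k \<le> t" "\<not> S (Suc k) \<le> t"
      then have "eventually (\<lambda>u. u \<in> {t<..<S (Suc k)}) (at_right t)"
        by (intro eventually_at_right_real) auto
      then have "eventually (\<lambda>u. (u - S k, S (Suc k) - u) = (A u, B u)) (at_right t)"
        by eventually_elim (use k AB[of k] in auto)
      moreover have "((\<lambda>u. (u - S k, S (Suc k) - u)) \<longlongrightarrow> (A t, B t)) (at_right t)"
        using AB[of k t] k by (auto intro!: tendsto_intros)
      ultimately show ?thesis by (rule Lim_transform_eventually[rotated])
    next
      assume k: "\<forall>k. S k \<le> t"
      have "eventually (\<lambda>u. u \<in> {t<..<t+1}) (at_right t)"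
        by (intro eventually_at_right_real) auto
      then have "eventually (\<lambda>u. (u, - u) = (A u, B u)) (at_right t)"
      proof eventually_elim
        fix u assume "u \<in> {t<..<t+1}"
        then have "S n \<le> u" for n using k[rule_format, of n] by auto
        then show "(u, - u) = (A u, B u)" using AB_inf by simp
      qed
      moreover have "((\<lambda>u. (u, - u)) \<longlongrightarrow> (A t, B t)) (at_right t)"
        using AB_inf[of t] k by (auto intro!: tendsto_intros)
      ultimately show ?thesis by (rule Lim_transform_eventually[rotated])
    qed
  qed
  have left: "\<exists>l. ((\<lambda>u. (A u, B u)) \<longlongrightarrow> l) (at_left t)" if t: "0 < t" for t
  proof -
    have "(\<exists>k. S k < t \<and> \<not> S (Suc k) < t) \<or> (\<forall>k. S k < t)"
      using step[of "\<lambda>k. S k < t"] S0 t by simp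
    then show ?thesis
    proof (elim disjE exE conjE)
      fix k assume k: "S k < t" "\<not> S (Suc k) < t"
      then have "eventually (\<lambda>u. u \<in> {S k<..<t}) (at_left t)"
        by (intro eventually_at_left_real) auto
      then have "eventually (\<lambda>u. (u - S k, S (Suc k) - u) = (A u, B u)) (at_left t)"
        by eventually_elim (use k AB[of k] in auto)
      moreover have "((\<lambda>u. (u - S k, S (Suc k) - u)) \<longlongrightarrow> (t - S k, S (Suc k) - t)) (at_left t)"
        by (auto intro!: tendsto_intros)
      ultimately show ?thesis by (intro exI) (rule Lim_transform_eventually[rotated])
    next
      assume k: "\<forall>k. S k < t"
      show ?thesis
      proof (cases "\<exists>r<t. \<forall>n. S n \<le> r")
        case True
        then obtain r where r: "r < t" "\<And>n. S n \<le> r" by blast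
        have "eventually (\<lambda>u. u \<in> {r<..<t}) (at_left t)"
          using r by (intro eventually_at_left_real) auto
        then have "eventually (\<lambda>u. (u, - u) = (A u, B u)) (at_left t)"
        proof eventually_elim
          fix u assume "u \<in> {r<..<t}"
          then have "S n \<le> u" for n using r(2)[of n] by auto
          then show "(u, - u) = (A u, B u)" using AB_inf by simp
        qed
        moreover have "((\<lambda>u. (u, - u)) \<longlongrightarrow> (t, - t)) (at_left t)"
          by (auto intro!: tendsto_intros)
        ultimately show ?thesis by (intro exI) (rule Lim_transform_eventually[rotated])
      next
        case False
        have bound: "eventually (\<lambda>u. \<bar>A u\<bar> < e \<and> \<bar>B u\<bar> < e) (at_left t)" if e: "0 < e" for e
        proof -
          have "t - e < t" using e by simp
          with False obtain n where n: "t - e < S n" by (meson not_le)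
          have "eventually (\<lambda>u. u \<in> {S n<..<t}) (at_left t)"
            using k by (intro eventually_at_left_real) auto
          then show ?thesis
          proof eventually_elim
            fix u assume u: "u \<in> {S n<..<t}"
            obtain m0 where m0: "u < S m0" using False u by (meson greaterThanLessThan_iff not_le)
            have "(\<exists>j. S (n + j) \<le> u \<and> \<not> S (n + Suc j) \<le> u) \<or> (\<forall>j. S (n + j) \<le> u)"
              using step[of "\<lambda>j. S (n + j) \<le> u"] u by simp
            moreover have "\<not> S (n + m0) \<le> u"
              using m0 Sle[of m0 "n + m0"] by linarith
            ultimately obtain j where j: "S (n + j) \<le> u" "u < S (Suc (n + j))" by auto
            have "S n \<le> S (n + j)" by (simp add: Sle)
            moreover have "S (Suc (n + j)) < t" using k by blast
            ultimately show "\<bar>A u\<bar> < e \<and> \<bar>B u\<bar> < e"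
              using AB[OF j] j n u by auto
          qed
        qed
        have "(A \<longlongrightarrow> 0) (at_left t)" "(B \<longlongrightarrow> 0) (at_left t)"
          by (rule tendstoI, drule bound, force elim: eventually_mono)+
        then show ?thesis by (intro exI[of _ "(0, 0)"] tendsto_Pair)
      qed
    qed
  qed
  define c where "c = 1 / T powr (1 / p)"
  have path: "scaled_recurrence_path \<tau> p T \<omega> = (\<lambda>v. c *\<^sub>R (A (T * v), B (T * v)))"
    by (simp add: fun_eq_iff scaled_recurrence_path_def A_def B_def c_def)
  have fl: "filterlim ((*) T) (at_left (T * v)) (at_left v)" for v
    unfolding filterlim_at using T
    by (auto intro!: tendsto_intros simp: eventually_at_filter)
  have fr: "filterlim ((*) T) (at_right (T * v)) (at_right v)" for v
    unfolding filterlim_at using T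
    by (auto intro!: tendsto_intros simp: eventually_at_filter)
  show ?thesis
    unfolding cadlag_def path
  proof (intro conjI ballI)
    fix v :: real assume "v \<in> {0..<1}"
    then have "((\<lambda>u. (A u, B u)) \<longlongrightarrow> (A (T * v), B (T * v))) (at_right (T * v))"
      using T by (intro right) auto
    from tendsto_scaleR[OF tendsto_const filterlim_compose[OF this fr]]
    show "((\<lambda>v. c *\<^sub>R (A (T * v), B (T * v))) \<longlongrightarrow> c *\<^sub>R (A (T * v), B (T * v))) (at_right v)" .
  next
    fix v :: real assume "v \<in> {0<..1}"
    then obtain l where "((\<lambda>u. (A u, B u)) \<longlongrightarrow> l) (at_left (T * v))"
      using T left[of "T * v"] by auto
    from tendsto_scaleR[OF tendsto_const filterlim_compose[OF this fl]]
    show "\<exists>l. ((\<lambda>v. c *\<^sub>R (A (T * v), B (T * v))) \<longlongrightarrow> l) (at_left v)" by blast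
  qed
qed

end

theory Submission
  imports Defs
begin

text \<open>The limit is a constant element of the Skorokhod space, so convergence in distribution follows from
  convergence in probability, that is, from a bound on the probability that the path is far from
  the zero function. If \<open>t\<close> lies between the \<open>k\<close>-th and the next renewal, both recurrence times are
  nonnegative and their sum is the gap \<open>\<tau> (k + 1)\<close>. As soon as the \<open>m\<close>-th renewal comes after \<open>T\<close>,
  the whole path on \<open>[0, T]\<close> is therefore bounded by the largest of the first \<open>m\<close> interarrival
  times, and a union bound (\<open>prob_recurrence_path_far_le\<close>) gives, for every \<open>m\<close>,
  \<open>P (distance > e) \<le> P (S\<^sub>m \<le> T) + m P (\<tau>\<^sub>1 > e T\<^bsup>1/p\<^esup>)\<close>.

  Take \<open>m = \<lceil>C T\<rceil>\<close>. A Chernoff bound shows that the first term is at most \<open>exp (- T)\<close> once \<open>C\<close> is large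
  (\<open>few_renewals_exponential_bound\<close>); this replaces the law of large numbers for the counting
  process. The second term is of order \<open>T P (\<tau>\<^sub>1\<^sup>p > e\<^sup>p T)\<close>, which tends to zero because
  \<open>\<tau>\<^sub>1\<^sup>p\<close> is integrable (\<open>tail_prob_tendsto_0\<close>).

  Convergence in distribution also requires the random paths to be Borel measurable for the Skorokhod
  topology, while the renewal structure only gives measurable coordinates. The link is
  \<open>borel_measurable_skorokhod_of\<close>: a cadlag function is the Skorokhod limit of the step functions that
  sample it on the grids of mesh \<open>1 / n\<close>, and each of these step functions depends continuously on
  finitely many coordinates.\<close>

section \<open>The Skorokhod metric\<close>

lemma dist_skorokhod_le:
  assumes "0 < e" "skorokhod_close e (Rep_skorokhod x) (Rep_skorokhod y)"
  shows "dist x y \<le> e"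
  unfolding dist_skorokhod_def
  using assms by (intro cInf_lower bdd_belowI[of _ 0]) auto

lemma dist_skorokhod_of_le:
  assumes "cadlag x" "cadlag y" "0 < e" "skorokhod_close e x y"
  shows "dist (skorokhod_of x) (skorokhod_of y) \<le> e"
proof (rule dist_skorokhod_le[OF \<open>0 < e\<close>])
  obtain \<mu> where \<mu>: "\<mu> \<in> time_changes"
    "\<And>t. t \<in> {0..1} \<Longrightarrow> \<bar>\<mu> t - t\<bar> \<le> e \<and> dist (x t) (y (\<mu> t)) \<le> e"
    using assms(4) unfolding skorokhod_close_def by blast
  have "\<mu> t \<in> {0..1}" if "t \<in> {0..1}" for t
    using \<mu>(1) that unfolding time_changes_def by blast
  then show "skorokhod_close e (Rep_skorokhod (skorokhod_of x)) (Rep_skorokhod (skorokhod_of y))"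
    unfolding skorokhod_close_def Rep_skorokhod_of[OF assms(1)] Rep_skorokhod_of[OF assms(2)]
    using \<mu> by (intro bexI[OF _ \<mu>(1)]) auto
qed

lemma dist_skorokhod_of_le_uniform:
  assumes "cadlag x" "cadlag y" "0 < e" "\<And>t. t \<in> {0..1} \<Longrightarrow> dist (x t) (y t) \<le> e"
  shows "dist (skorokhod_of x) (skorokhod_of y) \<le> e"
  by (rule dist_skorokhod_of_le[OF assms(1-3)], unfold skorokhod_close_def,
      rule bexI[OF _ time_changes_id]) (use assms in auto)

section \<open>Sampling a cadlag function on a grid\<close>

text \<open>On the right of \<open>t\<close> the index stays at \<open>\<lfloor>n t\<rfloor>\<close>; on the left it is \<open>\<lceil>n t\<rceil> - 1\<close>, which
  covers both the case that \<open>t\<close> is a grid point and the case that it is not.\<close>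

lemma cadlag_step:
  assumes n: "0 < n"
  shows "cadlag (\<lambda>v. y \<lfloor>real n * v\<rfloor>)"
  unfolding cadlag_def
proof (intro conjI ballI)
  fix t :: real
  let ?k = "\<lfloor>real n * t\<rfloor>"
  have "t < (of_int ?k + 1) / n" using n by (simp add: field_simps) linarith
  then have "eventually (\<lambda>u. u \<in> {t<..<(of_int ?k + 1) / n}) (at_right t)"
    by (rule eventually_at_right_real)
  then have "eventually (\<lambda>u. y ?k = y \<lfloor>real n * u\<rfloor>) (at_right t)"
  proof eventually_elim
    fix u assume u: "u \<in> {t<..<(of_int ?k + 1) / n}"
    then have "n * t < n * u" "n * u < of_int ?k + 1" using n by (auto simp: field_simps)
    then have "\<lfloor>real n * u\<rfloor> = ?k" by linarith
    then show "y ?k = y \<lfloor>real n * u\<rfloor>" by simp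
  qed
  then show "((\<lambda>v. y \<lfloor>real n * v\<rfloor>) \<longlongrightarrow> y ?k) (at_right t)"
    by (rule Lim_transform_eventually[OF tendsto_const])
next
  fix t :: real
  let ?k = "\<lceil>real n * t\<rceil> - 1"
  have "of_int ?k / n < t" using n by (simp add: field_simps) linarith
  then have "eventually (\<lambda>u. u \<in> {of_int ?k / n<..<t}) (at_left t)"
    by (rule eventually_at_left_real)
  then have "eventually (\<lambda>u. y ?k = y \<lfloor>real n * u\<rfloor>) (at_left t)"
  proof eventually_elim
    fix u assume u: "u \<in> {of_int ?k / n<..<t}"
    then have "n * u < n * t" "of_int ?k < n * u" using n by (auto simp: field_simps)
    then have "\<lfloor>real n * u\<rfloor> = ?k" by linarith
    then show "y ?k = y \<lfloor>real n * u\<rfloor>" by simp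
  qed
  then have "((\<lambda>v. y \<lfloor>real n * v\<rfloor>) \<longlongrightarrow> y ?k) (at_left t)"
    by (rule Lim_transform_eventually[OF tendsto_const])
  then show "\<exists>l. ((\<lambda>v. y \<lfloor>real n * v\<rfloor>) \<longlongrightarrow> l) (at_left t)" by blast
qed

definition grid_ceiling :: "nat \<Rightarrow> real \<Rightarrow> real" where
  "grid_ceiling n t = of_int \<lceil>real n * t\<rceil> / real n"

definition grid_floor :: "nat \<Rightarrow> real \<Rightarrow> real" where
  "grid_floor n t = of_int \<lfloor>real n * t\<rfloor> / real n"

text \<open>A partial time change from \<open>[a, b]\<close> that makes \<open>x\<close> close to its samples. The endpoints go to the
  grid points \<^emph>\<open>above\<close> them, so that a sampling point to the left of \<open>\<mu> t\<close> cannot lie before \<open>a\<close>.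
  The right endpoint is left out of the last condition because \<open>x\<close> may jump there. Fixing the
  endpoint values makes adjacent partial time changes fit together.\<close>

definition grid_matching :: "(real \<Rightarrow> 'a::metric_space) \<Rightarrow> real \<Rightarrow> nat \<Rightarrow> real \<Rightarrow> real \<Rightarrow> bool" where
  "grid_matching x e n a b \<longleftrightarrow>
     (\<exists>\<mu>. strict_mono_on {a..b} \<mu> \<and> continuous_on {a..b} \<mu> \<and>
        \<mu> a = grid_ceiling n a \<and> \<mu> b = grid_ceiling n b \<and>
        (\<forall>t\<in>{a..b}. \<bar>\<mu> t - t\<bar> \<le> 1 / n) \<and>
        (\<forall>t\<in>{a..<b}. dist (x t) (x (grid_floor n (\<mu> t))) \<le> e))"

lemma grid_ceiling_bounds:
  assumes "0 < n"
  shows "t \<le> grid_ceiling n t" "grid_ceiling n t < t + 1 / n"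
  using assms unfolding grid_ceiling_def by (simp_all add: field_simps) linarith+

lemma grid_matching_refl:
  assumes "0 < n"
  shows "grid_matching x e n a a"
  unfolding grid_matching_def
  using grid_ceiling_bounds[OF assms, of a]
  by (intro exI[of _ "\<lambda>_. grid_ceiling n a"]) (auto simp: strict_mono_on_def)

text \<open>The affine map between the prescribed endpoints works: \<open>\<mu> t\<close> lies in
  \<open>[grid_ceiling n a, grid_ceiling n b)\<close>, so the grid point below it lies in \<open>[a, b)\<close>, where \<open>x\<close>
  varies by at most \<open>e\<close>. A mesh below \<open>b - a\<close> keeps the two grid points apart.\<close>

lemma grid_matching_small_oscillation:
  assumes n: "0 < n" "1 / n < b - a"
    and osc: "\<And>u v. u \<in> {a..<b} \<Longrightarrow> v \<in> {a..<b} \<Longrightarrow> dist (x u) (x v) \<le> e"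
  shows "grid_matching x e n a b"
proof -
  let ?a = "grid_ceiling n a" and ?b = "grid_ceiling n b"
  define \<mu> where "\<mu> t = ?a + (t - a) / (b - a) * (?b - ?a)" for t
  have ab: "a < b" using n by (smt (verit) divide_nonneg_nonneg of_nat_0_le_iff)
  have lt: "?a < ?b" using grid_ceiling_bounds[OF n(1), of a] grid_ceiling_bounds[OF n(1), of b] n(2) by linarith
  have less: "\<mu> s < \<mu> t" if "s < t" for s t
    using that ab lt by (simp add: \<mu>_def divide_strict_right_mono)
  have ends: "\<mu> a = ?a" "\<mu> b = ?b" using ab by (auto simp: \<mu>_def)
  have "\<bar>\<mu> t - t\<bar> \<le> 1 / n" if t: "t \<in> {a..b}" for t
  proof -
    define l where "l = (t - a) / (b - a)"
    have l: "0 \<le> l" "l \<le> 1" using t ab by (auto simp: l_def)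
    have "t = a + l * (b - a)" using ab by (simp add: l_def)
    then have eq: "\<mu> t - t = (1 - l) * (?a - a) + l * (?b - b)"
      by (simp add: \<mu>_def l_def[symmetric] algebra_simps)
    have "(1 - l) * (?a - a) + l * (?b - b) \<le> (1 - l) * (1 / n) + l * (1 / n)"
      using l grid_ceiling_bounds[OF n(1), of a] grid_ceiling_bounds[OF n(1), of b]
      by (intro add_mono mult_left_mono) linarith+
    moreover have "0 \<le> (1 - l) * (?a - a) + l * (?b - b)"
      using l grid_ceiling_bounds[OF n(1), of a] grid_ceiling_bounds[OF n(1), of b] by simp
    moreover have "(1 - l) * (1 / n) + l * (1 / n) = 1 / n" by (simp flip: add_divide_distrib)
    ultimately show ?thesis unfolding eq by linarith
  qed
  moreover have "dist (x t) (x (grid_floor n (\<mu> t))) \<le> e" if t: "t \<in> {a..<b}" for t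
  proof (rule osc[OF t])
    have "\<mu> a \<le> \<mu> t" "\<mu> t < \<mu> b" using t less[of a t] less[of t b] by (cases "a = t"; auto)+
    \<comment> \<open>The integer strictly below \<open>\<lceil>n b\<rceil>\<close> is below \<open>n b\<close> itself.\<close>
    then have "of_int \<lceil>real n * a\<rceil> \<le> real n * \<mu> t" "real n * \<mu> t < of_int \<lceil>real n * b\<rceil>"
      using n(1) unfolding ends grid_ceiling_def by (auto simp: field_simps)
    then have "\<lceil>real n * a\<rceil> \<le> \<lfloor>real n * \<mu> t\<rfloor>" "\<lfloor>real n * \<mu> t\<rfloor> < \<lceil>real n * b\<rceil>"
      by linarith+
    then have "real n * a \<le> of_int \<lfloor>real n * \<mu> t\<rfloor>" "of_int \<lfloor>real n * \<mu> t\<rfloor> < real n * b"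
      by linarith+
    then show "grid_floor n (\<mu> t) \<in> {a..<b}"
      using n(1) by (auto simp: grid_floor_def field_simps)
  qed
  moreover have "continuous_on {a..b} \<mu>" using ab unfolding \<mu>_def by (auto intro!: continuous_intros)
  ultimately show ?thesis
    unfolding grid_matching_def using less ends by (intro exI[of _ \<mu>]) (auto simp: strict_mono_on_def)
qed

lemma grid_matching_trans:
  assumes "grid_matching x e n a b" "grid_matching x e n b c" "a \<le> b" "b \<le> c"
  shows "grid_matching x e n a c"
proof -
  obtain \<mu> where m: "strict_mono_on {a..b} \<mu>" "continuous_on {a..b} \<mu>"
    "\<mu> a = grid_ceiling n a" "\<mu> b = grid_ceiling n b"
    "\<And>t. t \<in> {a..b} \<Longrightarrow> \<bar>\<mu> t - t\<bar> \<le> 1 / n"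
    "\<And>t. t \<in> {a..<b} \<Longrightarrow> dist (x t) (x (grid_floor n (\<mu> t))) \<le> e"
    using assms(1) unfolding grid_matching_def by blast
  obtain \<nu> where v: "strict_mono_on {b..c} \<nu>" "continuous_on {b..c} \<nu>"
    "\<nu> b = grid_ceiling n b" "\<nu> c = grid_ceiling n c"
    "\<And>t. t \<in> {b..c} \<Longrightarrow> \<bar>\<nu> t - t\<bar> \<le> 1 / n"
    "\<And>t. t \<in> {b..<c} \<Longrightarrow> dist (x t) (x (grid_floor n (\<nu> t))) \<le> e"
    using assms(2) unfolding grid_matching_def by blast
  define \<rho> where "\<rho> t = (if t \<le> b then \<mu> t else \<nu> t)" for t
  have r: "\<rho> t = \<nu> t" if "b \<le> t" for t
    using that m(4) v(3) by (cases "t = b") (auto simp: \<rho>_def)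
  have "continuous_on ({a..b} \<union> {b..c}) \<rho>"
    unfolding \<rho>_def by (rule continuous_on_If) (use m v in auto)
  moreover have "{a..b} \<union> {b..c} = {a..c}" using assms by auto
  moreover have "\<rho> s < \<rho> t" if "s \<in> {a..c}" "t \<in> {a..c}" "s < t" for s t
  proof -
    consider "t \<le> b" | "b \<le> s" | "s < b" "b < t" by linarith
    then show ?thesis
    proof cases
      case 1
      then show ?thesis using that strict_mono_onD[OF m(1)] by (auto simp: \<rho>_def)
    next
      case 2
      then show ?thesis using that strict_mono_onD[OF v(1)] by (auto simp: r)
    next
      case 3
      then have "\<mu> s < \<mu> b" "\<nu> b < \<nu> t"
        using that strict_mono_onD[OF v(1)] strict_mono_onD[OF m(1)] by auto
      then show ?thesis using 3 m(4) v(3) by (auto simp: \<rho>_def)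
    qed
  qed
  moreover have "\<rho> a = grid_ceiling n a" "\<rho> c = grid_ceiling n c"
    using m(3) v(4) r assms(3,4) by (auto simp: \<rho>_def)
  moreover have "\<bar>\<rho> t - t\<bar> \<le> 1 / n" if "t \<in> {a..c}" for t
    using that m(5)[of t] v(5)[of t] by (auto simp: \<rho>_def)
  moreover have "dist (x t) (x (grid_floor n (\<rho> t))) \<le> e" if "t \<in> {a..<c}" for t
  proof (cases "t < b")
    case True
    then show ?thesis using that m(6)[of t] by (simp add: \<rho>_def)
  next
    case False
    then show ?thesis using that v(6)[of t] r[of t] by simp
  qed
  ultimately show ?thesis
    unfolding grid_matching_def strict_mono_on_def by (intro exI[of _ \<rho>]) auto
qed

text \<open>Near any \<open>t\<close>, a cadlag function varies little on each side of \<open>t\<close>, so short intervals around \<open>t\<close>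
  are matched in two pieces glued at \<open>t\<close>. Bolzano's bisection principle extends this to the unit
  interval; it takes the place of a finite partition into intervals of small oscillation.\<close>

lemma cadlag_eventually_grid_matching:
  assumes x: "cadlag x" and e: "0 < e"
  shows "\<forall>\<^sub>F n in sequentially. grid_matching x e n 0 1"
proof -
  define P where "P a b \<longleftrightarrow> (0 \<le> a \<longrightarrow> b \<le> 1 \<longrightarrow> (\<forall>\<^sub>F n in sequentially. grid_matching x e n a b))" for a b
  have "P 0 1"
  proof (rule Bolzano[OF zero_le_one])
    show "P a c" if "P a b" "P b c" "a \<le> b" "b \<le> c" for a b c
      unfolding P_def
    proof (intro impI)
      assume "0 \<le> a" "c \<le> 1"
      then have "\<forall>\<^sub>F n in sequentially. grid_matching x e n a b" "\<forall>\<^sub>F n in sequentially. grid_matching x e n b c"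
        using that by (auto simp: P_def)
      then show "\<forall>\<^sub>F n in sequentially. grid_matching x e n a c"
        by eventually_elim (rule grid_matching_trans, use that in auto)
    qed
  next
    fix t :: real assume local: "0 \<le> t" "t \<le> 1"
    have near: "dist (x u) (x v) \<le> e" if "dist (x u) l < e / 2" "dist (x v) l < e / 2" for u v l
      using dist_triangle_half_l[OF that] by simp
    have pos: "\<forall>\<^sub>F n::nat in sequentially. 0 < n" by (rule eventually_gt_at_top)
    have match: "\<forall>\<^sub>F n in sequentially. grid_matching x e n a b"
      if "a \<le> b" and osc: "\<And>u v. u \<in> {a..<b} \<Longrightarrow> v \<in> {a..<b} \<Longrightarrow> dist (x u) (x v) \<le> e" for a b
    proof (cases "a = b")
      case True
      show ?thesis unfolding True by (rule eventually_mono[OF pos grid_matching_refl])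
    next
      case False
      have "(\<lambda>n. 1 / real n) \<longlonglongrightarrow> 0" by (rule lim_1_over_n)
      then have "\<forall>\<^sub>F n in sequentially. 1 / real n < b - a"
        by (rule order_tendstoD) (use False that in auto)
      with pos show ?thesis
        by eventually_elim (rule grid_matching_small_oscillation, use osc in auto)
    qed
    obtain d1 where d1: "0 < d1" "t < 1 \<Longrightarrow> \<forall>u\<in>{t..<t+d1}. dist (x u) (x t) < e / 2"
    proof (cases "t < 1")
      case True
      then have "(x \<longlongrightarrow> x t) (at_right t)" using x local by (auto simp: cadlag_def)
      then have "\<forall>\<^sub>F u in at_right t. dist (x u) (x t) < e / 2" by (rule tendstoD) (use e in simp)
      then obtain b where b: "t < b" "\<And>u. t < u \<Longrightarrow> u < b \<Longrightarrow> dist (x u) (x t) < e / 2"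
        unfolding eventually_at_right_field by blast
      have "dist (x u) (x t) < e / 2" if "u \<in> {t..<t + (b - t)}" for u
        using that b(2)[of u] e by (cases "u = t") auto
      then show ?thesis using that[of "b - t"] b(1) by auto
    qed (use that[of 1] in auto)
    obtain d2 l where d2: "0 < d2" "0 < t \<Longrightarrow> \<forall>u\<in>{t-d2<..<t}. dist (x u) l < e / 2"
    proof (cases "0 < t")
      case True
      then obtain l where "(x \<longlongrightarrow> l) (at_left t)" using x local unfolding cadlag_def by force
      then have "\<forall>\<^sub>F u in at_left t. dist (x u) l < e / 2" by (rule tendstoD) (use e in simp)
      then obtain b where b: "b < t" "\<And>u. b < u \<Longrightarrow> u < t \<Longrightarrow> dist (x u) l < e / 2"
        unfolding eventually_at_left_field by blast
      then show ?thesis using that[of "t - b" l] by auto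
    qed (use that[of 1] in auto)
    show "\<exists>d>0. \<forall>a b. a \<le> t \<and> t \<le> b \<and> b - a < d \<longrightarrow> P a b"
      unfolding P_def
    proof (intro exI[of _ "min d1 d2"] conjI allI impI)
      show "0 < min d1 d2" using d1 d2 by simp
      fix a b assume ab: "a \<le> t \<and> t \<le> b \<and> b - a < min d1 d2" "0 \<le> a" "b \<le> 1"
      have "\<forall>\<^sub>F n in sequentially. grid_matching x e n a t"
        using ab d2 by (intro match near[of _ l]) auto
      moreover have "\<forall>\<^sub>F n in sequentially. grid_matching x e n t b"
        using ab d1 by (intro match near[of _ "x t"]) auto
      ultimately show "\<forall>\<^sub>F n in sequentially. grid_matching x e n a b"
        by eventually_elim (rule grid_matching_trans, use ab in auto)
    qed
  qed
  then show ?thesis by (simp add: P_def)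
qed

text \<open>On the unit interval the prescribed endpoints are \<open>0\<close> and \<open>1\<close>, so a matching is a time change;
  at \<open>t = 1\<close>, not covered by the matching, the sampled function agrees with \<open>x\<close>.\<close>

lemma skorokhod_close_grid_matching:
  assumes n: "0 < n" "1 / n \<le> e" and gm: "grid_matching x e n 0 1"
  shows "skorokhod_close e x (\<lambda>v. x (grid_floor n v))"
proof -
  obtain \<mu> where m: "strict_mono_on {0..1} \<mu>" "continuous_on {0..1} \<mu>"
    "\<mu> 0 = grid_ceiling n 0" "\<mu> 1 = grid_ceiling n 1"
    "\<And>t. t \<in> {0..1} \<Longrightarrow> \<bar>\<mu> t - t\<bar> \<le> 1 / n"
    "\<And>t. t \<in> {0..<1} \<Longrightarrow> dist (x t) (x (grid_floor n (\<mu> t))) \<le> e"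
    using gm unfolding grid_matching_def by blast
  have ends: "\<mu> 0 = 0" "\<mu> 1 = 1" using m(3,4) n(1) by (simp_all add: grid_ceiling_def)
  have "\<mu> ` {0..1} = {0..1}"
  proof
    show "\<mu> ` {0..1} \<subseteq> {0..1}"
      using strict_mono_on_leD[OF m(1), of 0] strict_mono_on_leD[OF m(1), of _ 1] ends by force
    show "{0..1} \<subseteq> \<mu> ` {0..1}"
      using IVT'[of \<mu> 0 _ 1] m(2) ends by force
  qed
  then have tc: "\<mu> \<in> time_changes" using m by (simp add: time_changes_def)
  have "0 < e" using n by (smt (verit) divide_pos_pos of_nat_0_less_iff)
  then have "dist (x t) (x (grid_floor n (\<mu> t))) \<le> e" if "t \<in> {0..1}" for t
    using that m(6)[of t] ends n(1) by (cases "t = 1") (auto simp: grid_floor_def)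
  then show ?thesis
    unfolding skorokhod_close_def using m(5) n(2) by (intro bexI[OF _ tc]) force
qed

lemma cadlag_grid_floor: "0 < n \<Longrightarrow> cadlag (\<lambda>v. x (grid_floor n v))"
  unfolding grid_floor_def by (rule cadlag_step[where y = "\<lambda>k. x (of_int k / _)"])

lemma tendsto_skorokhod_of_grid_floor:
  assumes "cadlag x"
  shows "(\<lambda>n. skorokhod_of (\<lambda>v. x (grid_floor n v))) \<longlonglongrightarrow> skorokhod_of x"
proof (rule tendstoI)
  fix e :: real assume e: "0 < e"
  have "\<forall>\<^sub>F n::nat in sequentially. 0 < n" by (rule eventually_gt_at_top)
  moreover have "\<forall>\<^sub>F n in sequentially. 1 / real n < e / 2"
    by (rule order_tendstoD[OF lim_1_over_n]) (use e in simp)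
  moreover have "\<forall>\<^sub>F n in sequentially. grid_matching x (e / 2) n 0 1"
    by (rule cadlag_eventually_grid_matching) (use assms e in auto)
  ultimately show "\<forall>\<^sub>F n in sequentially. dist (skorokhod_of (\<lambda>v. x (grid_floor n v))) (skorokhod_of x) < e"
  proof eventually_elim
    case (elim n)
    have "dist (skorokhod_of (\<lambda>v. x (grid_floor n v))) (skorokhod_of x) \<le> e / 2"
      using elim e assms
      by (intro dist_skorokhod_of_le cadlag_grid_floor skorokhod_close_sym[OF skorokhod_close_grid_matching]) auto
    then show ?case using e by simp
  qed
qed

section \<open>Measurability of random cadlag paths\<close>

text \<open>In the product topology closeness is controlled on finitely many coordinates at a time; on the
  unit interval the step function takes only the values \<open>y 0, \<dots>, y n\<close>.\<close>

lemma continuous_skorokhod_of_step: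
  assumes n: "0 < n"
  shows "continuous_on UNIV (\<lambda>y :: nat \<Rightarrow> 'a::metric_space. skorokhod_of (\<lambda>v. y (nat \<lfloor>real n * v\<rfloor>)))"
proof -
  have "((\<lambda>y. skorokhod_of (\<lambda>v. y (nat \<lfloor>real n * v\<rfloor>))) \<longlongrightarrow> skorokhod_of (\<lambda>v. y (nat \<lfloor>real n * v\<rfloor>))) (at y)"
    for y :: "nat \<Rightarrow> 'a"
  proof (rule tendstoI)
    fix e :: real assume e: "0 < e"
    have "\<forall>\<^sub>F z in at y. dist (z i) (y i) < e / 2" for i
    proof (rule tendstoD)
      have "isCont (\<lambda>z. z i) y"
        by (rule continuous_on_interior[OF continuous_on_product_coordinates]) simp
      then show "((\<lambda>z. z i) \<longlongrightarrow> y i) (at y)" by (simp add: isCont_def)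
    qed (use e in simp)
    then have "\<forall>\<^sub>F z in at y. \<forall>i\<in>{..n}. dist (z i) (y i) < e / 2"
      by (intro eventually_ball_finite) auto
    then show "\<forall>\<^sub>F z in at y. dist (skorokhod_of (\<lambda>v. z (nat \<lfloor>real n * v\<rfloor>)))
        (skorokhod_of (\<lambda>v. y (nat \<lfloor>real n * v\<rfloor>))) < e"
    proof eventually_elim
      case (elim z)
      have "nat \<lfloor>real n * v\<rfloor> \<le> n" if "v \<in> {0..1}" for v
      proof -
        have "real n * v \<le> real n * 1" using that by (intro mult_left_mono) auto
        then have "\<lfloor>real n * v\<rfloor> \<le> int n" by linarith
        then show ?thesis by linarith
      qed
      then have "dist (skorokhod_of (\<lambda>v. z (nat \<lfloor>real n * v\<rfloor>)))
          (skorokhod_of (\<lambda>v. y (nat \<lfloor>real n * v\<rfloor>))) \<le> e / 2"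
        using elim e
        by (intro dist_skorokhod_of_le_uniform cadlag_step[OF n, of "\<lambda>k. z (nat k)"]
            cadlag_step[OF n, of "\<lambda>k. y (nat k)"]) (auto intro: less_imp_le)
      then show ?case using e by simp
    qed
  qed
  then show ?thesis by (simp add: continuous_on_eq_continuous_at isCont_def)
qed

text \<open>Measurable coordinates suffice: the sampled path is a continuous function of a measurable random
  sequence, and a pointwise limit of Borel maps into a metric space is Borel.\<close>

lemma borel_measurable_skorokhod_of:
  fixes X :: "'w \<Rightarrow> real \<Rightarrow> 'a::{metric_space, second_countable_topology}"
  assumes cad: "\<And>\<omega>. \<omega> \<in> space M \<Longrightarrow> cadlag (X \<omega>)"
    and meas: "\<And>v. v \<in> {0..1} \<Longrightarrow> (\<lambda>\<omega>. X \<omega> v) \<in> borel_measurable M"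
  shows "(\<lambda>\<omega>. skorokhod_of (X \<omega>)) \<in> borel_measurable M"
proof (rule borel_measurable_LIMSEQ_metric)
  show "(\<lambda>n. skorokhod_of (\<lambda>v. X \<omega> (grid_floor (Suc n) v))) \<longlonglongrightarrow> skorokhod_of (X \<omega>)"
    if "\<omega> \<in> space M" for \<omega>
    using tendsto_skorokhod_of_grid_floor[OF cad[OF that]] by (rule LIMSEQ_Suc)
  fix m
  define n where "n = Suc m"
  \<comment> \<open>The indices \<open>i > n\<close> are never read; the minimum keeps their sampling times in the unit interval.\<close>
  define y where "y \<omega> i = X \<omega> (min 1 (real i / n))" for \<omega> i
  have y: "y \<in> borel_measurable M"
    unfolding y_def by (intro measurable_coordinatewise_then_product meas) auto
  have "skorokhod_of (\<lambda>v. X \<omega> (grid_floor n v)) = skorokhod_of (\<lambda>v. y \<omega> (nat \<lfloor>real n * v\<rfloor>))" for \<omega>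
  proof -
    have "X \<omega> (grid_floor n v) = y \<omega> (nat \<lfloor>real n * v\<rfloor>)" if "v \<in> {0..1}" for v
    proof -
      have "real n * v \<le> real n * 1" using that by (intro mult_left_mono) auto
      then have "of_int \<lfloor>real n * v\<rfloor> \<le> real n" by linarith
      then have "grid_floor n v \<le> 1" by (simp add: grid_floor_def n_def field_simps)
      moreover have "real (nat \<lfloor>real n * v\<rfloor>) = of_int \<lfloor>real n * v\<rfloor>" using that by simp
      ultimately show ?thesis by (simp add: y_def grid_floor_def)
    qed
    then have "restrict (\<lambda>v. X \<omega> (grid_floor n v)) {0..1} = restrict (\<lambda>v. y \<omega> (nat \<lfloor>real n * v\<rfloor>)) {0..1}"
      by (rule restrict_ext)
    then show ?thesis by (simp add: skorokhod_of_def)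
  qed
  moreover have "(\<lambda>\<omega>. skorokhod_of (\<lambda>v. y \<omega> (nat \<lfloor>real n * v\<rfloor>))) \<in> borel_measurable M"
    by (rule borel_measurable_continuous_on[OF continuous_skorokhod_of_step y]) (simp add: n_def)
  ultimately show "(\<lambda>\<omega>. skorokhod_of (\<lambda>v. X \<omega> (grid_floor (Suc m) v))) \<in> borel_measurable M"
    by (simp add: n_def)
qed

section \<open>Convergence in probability to a constant\<close>

text \<open>A bounded continuous test function changes by less than \<open>e / 2\<close> on a ball around \<open>c\<close> and by at most
  \<open>2 K\<close> outside it, and the outside has vanishing probability.\<close>

lemma (in prob_space) converges_in_distribution_constI:
  fixes X :: "'i \<Rightarrow> 'a \<Rightarrow> 'b::metric_space"
  assumes meas: "\<forall>\<^sub>F i in F. X i \<in> borel_measurable M"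
    and lim: "\<And>e. 0 < e \<Longrightarrow> ((\<lambda>i. prob {\<omega>\<in>space M. e < dist (X i \<omega>) c}) \<longlongrightarrow> 0) F"
  shows "converges_in_distribution M X (\<lambda>_. c) F"
  unfolding converges_in_distribution_def
proof (intro conjI allI impI)
  fix f :: "'b \<Rightarrow> real"
  assume cont: "continuous_on UNIV f" and bdd: "bounded (range f)"
  obtain K where K: "\<And>x. \<bar>f x\<bar> \<le> K"
    using bdd unfolding bounded_iff by auto
  have K0: "0 \<le> K" using K[of c] by linarith
  show "((\<lambda>i. \<integral>\<omega>. f (X i \<omega>) \<partial>M) \<longlongrightarrow> (\<integral>\<omega>. f c \<partial>M)) F"
  proof (rule tendstoI)
    fix e :: real assume e: "0 < e"
    obtain d where d: "0 < d" "\<And>x. dist x c < d \<Longrightarrow> dist (f x) (f c) < e / 2"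
      using cont e unfolding continuous_on_iff by (metis half_gt_zero UNIV_I)
    define B where "B i = {\<omega>\<in>space M. d / 2 < dist (X i \<omega>) c}" for i
    have "((\<lambda>i. 2 * K * prob (B i)) \<longlongrightarrow> 2 * K * 0) F"
      unfolding B_def using d by (intro tendsto_intros lim) auto
    then have "\<forall>\<^sub>F i in F. 2 * K * prob (B i) < e / 2"
      by (rule order_tendstoD) (use e in simp)
    with meas show "\<forall>\<^sub>F i in F. dist (\<integral>\<omega>. f (X i \<omega>) \<partial>M) (\<integral>\<omega>. f c \<partial>M) < e"
    proof eventually_elim
      case (elim i)
      have [measurable]: "X i \<in> borel_measurable M" by fact
      have [measurable]: "(\<lambda>\<omega>. f (X i \<omega>)) \<in> borel_measurable M"
        by (rule borel_measurable_continuous_on[OF cont]) simp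
      have [measurable]: "(\<lambda>\<omega>. dist (X i \<omega>) c) \<in> borel_measurable M"
        by (rule borel_measurable_continuous_on[where f = "\<lambda>x. dist x c"]) (auto intro!: continuous_intros)
      have [measurable]: "B i \<in> sets M" unfolding B_def by measurable
      have int: "integrable M (\<lambda>\<omega>. f (X i \<omega>))"
        by (rule integrable_const_bound[of _ K]) (use K in auto)
      have "\<bar>(\<integral>\<omega>. f (X i \<omega>) \<partial>M) - f c\<bar> = \<bar>\<integral>\<omega>. f (X i \<omega>) - f c \<partial>M\<bar>"
        using int by (simp add: prob_space)
      also have "\<dots> \<le> (\<integral>\<omega>. \<bar>f (X i \<omega>) - f c\<bar> \<partial>M)"
        by (rule integral_abs_bound)
      also have "\<dots> \<le> (\<integral>\<omega>. e / 2 + 2 * K * indicator (B i) \<omega> \<partial>M)"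
      proof (rule integral_mono)
        fix \<omega> assume w: "\<omega> \<in> space M"
        show "\<bar>f (X i \<omega>) - f c\<bar> \<le> e / 2 + 2 * K * indicator (B i) \<omega>"
        proof (cases "\<omega> \<in> B i")
          case True
          then show ?thesis using K[of c] K[of "X i \<omega>"] e by simp
        next
          case False
          then have "dist (X i \<omega>) c < d" using w d(1) by (auto simp: B_def)
          then show ?thesis using d(2) False by (fastforce simp: dist_real_def)
        qed
      qed (use int in \<open>auto simp: emeasure_eq_measure\<close>)
      also have "\<dots> = e / 2 + 2 * K * prob (B i)"
        by (subst Bochner_Integration.integral_add) (auto simp: prob_space emeasure_eq_measure)
      finally show ?case using elim by (simp add: dist_real_def prob_space)
    qed
  qed
qed (use meas in auto)

section \<open>Recurrence times\<close>

text \<open>If \<open>t\<close> falls between the renewals \<open>k\<close> and \<open>k + 1\<close>, the two recurrence times add up to the gap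
  \<open>\<tau> (k + 1)\<close>. The hypothesis \<open>t < arrival \<tau> m \<omega>\<close> ensures \<open>k + 1 \<le> m\<close>, and in particular that only
  finitely many renewals occur up to \<open>t\<close>.\<close>

lemma recurrence_sum_le:
  assumes pos: "\<And>n. 1 \<le> n \<Longrightarrow> 0 < \<tau> n \<omega>"
    and t: "0 \<le> t" "t < arrival \<tau> m \<omega>"
    and small: "\<And>i. i \<in> {1..m} \<Longrightarrow> \<tau> i \<omega> \<le> h"
  shows "0 \<le> backward_recurrence \<tau> t \<omega>" "0 \<le> forward_recurrence \<tau> t \<omega>"
    "backward_recurrence \<tau> t \<omega> + forward_recurrence \<tau> t \<omega> \<le> h"
proof -
  define S where "S n = arrival \<tau> n \<omega>" for n
  have S0: "S 0 = 0" and SSuc: "S (Suc n) = S n + \<tau> (Suc n) \<omega>" for n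
    by (simp_all add: S_def arrival_def)
  have "S n < S (Suc n)" for n using pos[of "Suc n"] by (simp add: SSuc)
  then have "strict_mono S" by (rule strict_monoI_Suc)
  then have Sle: "S i \<le> S j \<longleftrightarrow> i \<le> j" for i j by (rule strict_mono_less_eq)
  define l where "l = (LEAST n. t < S n)"
  have l: "t < S l" "l \<le> m" and l_le: "t < S n \<Longrightarrow> l \<le> n" for n
    using t(2) unfolding l_def S_def by (auto intro: LeastI Least_le)
  obtain k where k: "l = Suc k" using l(1) t(1) S0 by (cases l) auto
  have Sk: "S k \<le> t" using l_le[of k] k by fastforce
  have "{n. S n \<le> t} = {..k}"
    using Sk l(1) Sle k by (auto; metis not_less_eq_eq order_less_le_trans order_trans leD)
  then have "renewal_count \<tau> t \<omega> = Suc k" by (simp add: renewal_count_def S_def)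
  then have AB: "backward_recurrence \<tau> t \<omega> = t - S k" "forward_recurrence \<tau> t \<omega> = S (Suc k) - t"
    by (simp_all add: backward_recurrence_def forward_recurrence_def S_def)
  then show "0 \<le> backward_recurrence \<tau> t \<omega>" "0 \<le> forward_recurrence \<tau> t \<omega>"
    using Sk l k by auto
  show "backward_recurrence \<tau> t \<omega> + forward_recurrence \<tau> t \<omega> \<le> h"
    using small[of "Suc k"] l(2) k by (simp add: AB SSuc)
qed

lemma borel_measurable_arrival:
  assumes "\<And>n. 1 \<le> n \<Longrightarrow> \<tau> n \<in> borel_measurable M"
  shows "arrival \<tau> n \<in> borel_measurable M"
  unfolding arrival_def using assms by (intro borel_measurable_sum) auto

lemma borel_measurable_scaled_recurrence_path:
  assumes \<tau>: "\<And>n. 1 \<le> n \<Longrightarrow> \<tau> n \<in> borel_measurable M"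
  shows "(\<lambda>\<omega>. scaled_recurrence_path \<tau> p T \<omega> v) \<in> borel_measurable M"
proof -
  note [measurable] = borel_measurable_arrival[OF \<tau>]
  have [measurable]: "renewal_count \<tau> t \<in> measurable M (count_space UNIV)" for t
    unfolding renewal_count_def by measurable
  have "(\<lambda>\<omega>. arrival \<tau> (g (renewal_count \<tau> t \<omega>)) \<omega>) \<in> borel_measurable M" for g t
    by (rule measurable_compose_countable) measurable
  note [measurable] = this[of "\<lambda>n. n - 1"] this[of "\<lambda>n. n"]
  show ?thesis
    unfolding scaled_recurrence_path_def backward_recurrence_def forward_recurrence_def
    by measurable
qed

lemma dist_scaled_recurrence_path_zero_le:
  assumes pos: "\<And>n. 1 \<le> n \<Longrightarrow> 0 < \<tau> n \<omega>" and T: "0 < T" and e: "0 < e"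
    and arr: "T < arrival \<tau> m \<omega>"
    and small: "\<And>i. i \<in> {1..m} \<Longrightarrow> \<tau> i \<omega> \<le> e * T powr (1 / p)"
  shows "dist (skorokhod_of (scaled_recurrence_path \<tau> p T \<omega>)) (skorokhod_of (\<lambda>v. (0, 0))) \<le> e"
proof (rule dist_skorokhod_of_le_uniform[OF cadlag_scaled_recurrence_path _ e])
  show "cadlag (\<lambda>v. (0::real, 0::real))" by (auto simp: cadlag_def)
  fix v :: real assume v: "v \<in> {0..1}"
  define A B where "A = backward_recurrence \<tau> (T * v) \<omega>" and "B = forward_recurrence \<tau> (T * v) \<omega>"
  define c where "c = T powr (1 / p)"
  have c: "0 < c" using T by (simp add: c_def)
  have "0 \<le> T * v" "T * v \<le> T * 1" using v T by auto
  then have "0 \<le> T * v" "T * v < arrival \<tau> m \<omega>" using arr by linarith+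
  from recurrence_sum_le[of \<tau> \<omega>, OF pos this small]
  have AB: "0 \<le> A" "0 \<le> B" "A + B \<le> e * c" by (auto simp: A_def B_def c_def)
  have "dist (scaled_recurrence_path \<tau> p T \<omega> v) (0, 0) = norm (A / c, B / c)"
    by (simp add: scaled_recurrence_path_def A_def B_def c_def dist_norm)
  also have "\<dots> \<le> norm (A / c) + norm (B / c)" by (rule norm_Pair_le)
  also have "\<dots> = (A + B) / c" using AB c by (simp add: add_divide_distrib)
  also have "\<dots> \<le> e" using AB c by (simp add: field_simps)
  finally show "dist (scaled_recurrence_path \<tau> p T \<omega> v) (0, 0) \<le> e" .
qed (use pos T in auto)

section \<open>Probability estimates\<close>

text \<open>Markov's inequality only gives boundedness. The improvement comes from dominated convergence:
  \<open>T\<close> times the indicator of \<open>a T < Y\<close> is at most \<open>Y / a\<close> and vanishes for large \<open>T\<close>.\<close>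

lemma (in prob_space) tail_prob_tendsto_0:
  fixes Y :: "'a \<Rightarrow> real"
  assumes int: "integrable M Y" and "\<And>\<omega>. \<omega> \<in> space M \<Longrightarrow> 0 \<le> Y \<omega>" and a: "0 < a"
  shows "((\<lambda>T. T * prob {\<omega>\<in>space M. a * T < Y \<omega>}) \<longlongrightarrow> 0) at_top"
proof -
  have [measurable]: "Y \<in> borel_measurable M" using int by simp
  define s where "s T \<omega> = T * indicator {\<omega>\<in>space M. a * T < Y \<omega>} \<omega>" for T \<omega>
  have "((\<lambda>T. integral\<^sup>L M (s T)) \<longlongrightarrow> integral\<^sup>L M (\<lambda>_. 0)) at_top"
  proof (rule integral_dominated_convergence_at_top[where w = "\<lambda>\<omega>. Y \<omega> / a"])
    show "s T \<in> borel_measurable M" for T unfolding s_def by measurable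
    show "integrable M (\<lambda>\<omega>. Y \<omega> / a)" using int by simp
    show "AE \<omega> in M. ((\<lambda>T. s T \<omega>) \<longlongrightarrow> 0) at_top"
    proof (rule AE_I2)
      fix \<omega>
      have "\<forall>\<^sub>F T in at_top. Y \<omega> / a < T" by (rule eventually_gt_at_top)
      then have "\<forall>\<^sub>F T in at_top. 0 = s T \<omega>"
        by eventually_elim (use a in \<open>auto simp: s_def field_simps indicator_def\<close>)
      then show "((\<lambda>T. s T \<omega>) \<longlongrightarrow> 0) at_top" by (rule Lim_transform_eventually[OF tendsto_const])
    qed
    have "\<forall>\<^sub>F T::real in at_top. 0 \<le> T" by (rule eventually_ge_at_top)
    then show "\<forall>\<^sub>F T in at_top. AE \<omega> in M. norm (s T \<omega>) \<le> Y \<omega> / a"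
      by eventually_elim (use a assms(2) in \<open>auto simp: s_def field_simps indicator_def\<close>)
  qed simp
  moreover have "integral\<^sup>L M (s T) = T * prob {\<omega>\<in>space M. a * T < Y \<omega>}" for T
    unfolding s_def by (simp add: emeasure_eq_measure)
  ultimately show ?thesis by simp
qed

lemma (in prob_space) integrable_powr_le_exponent:
  fixes Y :: "'a \<Rightarrow> real"
  assumes [measurable]: "Y \<in> borel_measurable M" and nonneg: "\<And>\<omega>. \<omega> \<in> space M \<Longrightarrow> 0 \<le> Y \<omega>"
    and int: "integrable M (\<lambda>\<omega>. Y \<omega> powr s)" and ps: "0 < p" "p \<le> s"
  shows "integrable M (\<lambda>\<omega>. Y \<omega> powr p)"
proof (rule Bochner_Integration.integrable_bound)
  show "integrable M (\<lambda>\<omega>. 1 + Y \<omega> powr s)" using int by simp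
  have "y powr p \<le> 1 + y powr s" if "0 \<le> y" for y :: real
  proof (cases "y \<le> 1")
    case True
    then have "y powr p \<le> 1" using that ps by (intro powr_le1) auto
    then show ?thesis by (smt (verit) powr_ge_zero)
  next
    case False
    then have "y powr p \<le> y powr s" using ps by (intro powr_mono) auto
    then show ?thesis by simp
  qed
  then show "AE \<omega> in M. norm (Y \<omega> powr p) \<le> norm (1 + Y \<omega> powr s)"
    using nonneg by (intro AE_I2) simp
qed measurable

text \<open>The Chernoff bound: Markov's inequality for \<open>exp (- S\<^sub>m)\<close>, whose expectation factorises by
  independence.\<close>

lemma (in prob_space) prob_sum_le_exp_power:
  assumes indep: "indep_vars (\<lambda>_. borel) \<tau> {1..}"
    and ident: "\<And>n. 1 \<le> n \<Longrightarrow> distr M borel (\<tau> n) = distr M borel (\<tau> 1)"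
    and pos: "\<And>n \<omega>. 1 \<le> n \<Longrightarrow> \<omega> \<in> space M \<Longrightarrow> 0 < \<tau> n \<omega>"
  shows "prob {\<omega>\<in>space M. arrival \<tau> m \<omega> \<le> t} \<le> exp t * (expectation (\<lambda>\<omega>. exp (- \<tau> 1 \<omega>))) ^ m"
proof -
  have \<tau>[measurable]: "\<tau> n \<in> borel_measurable M" if "1 \<le> n" for n
    using indep that unfolding indep_vars_def by auto
  have [measurable]: "arrival \<tau> m \<in> borel_measurable M" by (rule borel_measurable_arrival) fact
  have int: "integrable M (\<lambda>\<omega>. exp (- \<tau> n \<omega>))" if "1 \<le> n" for n
    by (rule integrable_const_bound[of _ 1]) (use \<tau>[OF that] pos[OF that] in \<open>auto intro: less_imp_le\<close>)
  have same: "expectation (\<lambda>\<omega>. exp (- \<tau> n \<omega>)) = expectation (\<lambda>\<omega>. exp (- \<tau> 1 \<omega>))" if n: "1 \<le> n" for n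
    using integral_distr[of "\<tau> n" M borel "\<lambda>x. exp (- x)"] integral_distr[of "\<tau> 1" M borel "\<lambda>x. exp (- x)"]
      ident[OF n] \<tau>[OF n] \<tau>[of 1] by simp
  have ind: "indep_vars (\<lambda>_. borel) (\<lambda>i \<omega>. exp (- \<tau> i \<omega>)) {1..m}"
    by (rule indep_vars_compose2[OF indep_vars_subset[OF indep], where N = "\<lambda>_. borel" and Y = "\<lambda>_ x. exp (- x)"]) auto
  have prod: "exp (- arrival \<tau> m \<omega>) = (\<Prod>i=1..m. exp (- \<tau> i \<omega>))" for \<omega>
    by (simp add: arrival_def sum_negf[symmetric] exp_sum)
  have "integrable M (\<lambda>\<omega>. \<Prod>i=1..m. exp (- \<tau> i \<omega>))"
    by (rule indep_vars_integrable) (use ind int in auto)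
  then have intS: "integrable M (\<lambda>\<omega>. exp (- arrival \<tau> m \<omega>))" by (simp add: prod)
  have "expectation (\<lambda>\<omega>. exp (- arrival \<tau> m \<omega>)) = (\<Prod>i=1..m. expectation (\<lambda>\<omega>. exp (- \<tau> i \<omega>)))"
    unfolding prod by (rule indep_vars_lebesgue_integral) (use ind int in auto)
  also have "\<dots> = (\<Prod>i=1..m. expectation (\<lambda>\<omega>. exp (- \<tau> 1 \<omega>)))"
    by (rule prod.cong[OF refl same]) simp
  also have "\<dots> = (expectation (\<lambda>\<omega>. exp (- \<tau> 1 \<omega>))) ^ m" by simp
  finally have E: "expectation (\<lambda>\<omega>. exp (- arrival \<tau> m \<omega>)) = (expectation (\<lambda>\<omega>. exp (- \<tau> 1 \<omega>))) ^ m" .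
  have "{\<omega>\<in>space M. arrival \<tau> m \<omega> \<le> t} = {\<omega>\<in>space M. exp (- arrival \<tau> m \<omega>) \<ge> exp (- t)}" by simp
  also have "prob \<dots> \<le> expectation (\<lambda>\<omega>. exp (- arrival \<tau> m \<omega>)) / exp (- t)"
    by (rule integral_Markov_inequality_measure[OF intS, of "{}"]) auto
  also have "\<dots> = exp t * (expectation (\<lambda>\<omega>. exp (- \<tau> 1 \<omega>))) ^ m"
    unfolding E by (simp add: exp_minus field_simps)
  finally show ?thesis .
qed

text \<open>Since \<open>\<tau> 1\<close> is positive, \<open>q = E (exp (- \<tau>\<^sub>1))\<close> is less than one, so \<open>exp T * q ^ m\<close> is at most
  \<open>exp (- T)\<close> when \<open>m\<close> exceeds a fixed multiple of \<open>T\<close>. Up to an exponentially small probability,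
  the number of renewals thus grows at most linearly, whatever the mean of \<open>\<tau> 1\<close>.\<close>

lemma (in prob_space) few_renewals_exponential_bound:
  assumes indep: "indep_vars (\<lambda>_. borel) \<tau> {1..}"
    and ident: "\<And>n. 1 \<le> n \<Longrightarrow> distr M borel (\<tau> n) = distr M borel (\<tau> 1)"
    and pos: "\<And>n \<omega>. 1 \<le> n \<Longrightarrow> \<omega> \<in> space M \<Longrightarrow> 0 < \<tau> n \<omega>"
  obtains C where "0 < C"
    "\<And>m T. C * T \<le> real m \<Longrightarrow> prob {\<omega>\<in>space M. arrival \<tau> m \<omega> \<le> T} \<le> exp (- T)"
proof -
  have \<tau>1[measurable]: "\<tau> 1 \<in> borel_measurable M"
    using indep unfolding indep_vars_def by auto
  define q where "q = expectation (\<lambda>\<omega>. exp (- \<tau> 1 \<omega>))"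
  have q_int: "integrable M (\<lambda>\<omega>. exp (- \<tau> 1 \<omega>))"
    by (rule integrable_const_bound[of _ 1]) (use \<tau>1 pos[of 1] in \<open>auto intro: less_imp_le\<close>)
  have "expectation (\<lambda>_. 0) < q" unfolding q_def
    by (rule integral_less_AE_space) (use q_int in \<open>auto simp: emeasure_space_1\<close>)
  then have q0: "0 < q" by simp
  have q1: "q < 1" unfolding q_def
    by (rule expectation_less[OF q_int]) (use pos[of 1] in auto)
  have ln_q: "ln q < 0" using q0 q1 by simp
  \<comment> \<open>With this constant \<open>q powr (C * T) = exp (- 2 * T)\<close>, which beats the factor \<open>exp T\<close>.\<close>
  define C where "C = 2 / (- ln q)"
  show ?thesis
  proof
    show "0 < C" using ln_q by (simp add: C_def)
    fix m T assume m: "C * T \<le> real m"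
    have "q ^ m = exp (m * ln q)" using q0 by (simp add: exp_of_nat_mult)
    also have "\<dots> \<le> exp (C * T * ln q)" using m ln_q by (simp add: mult_right_mono_neg)
    also have "C * T * ln q = - 2 * T" using ln_q by (simp add: C_def)
    finally have "exp T * q ^ m \<le> exp T * exp (- 2 * T)" by simp
    also have "\<dots> = exp (- T)" by (simp flip: exp_add)
    finally show "prob {\<omega>\<in>space M. arrival \<tau> m \<omega> \<le> T} \<le> exp (- T)"
      using prob_sum_le_exp_power[OF indep ident pos, of m T] unfolding q_def by linarith
  qed
qed

lemma (in prob_space) prob_greater_eq_of_distr_eq:
  fixes X Y :: "'a \<Rightarrow> real"
  assumes X: "X \<in> borel_measurable M" and Y: "Y \<in> borel_measurable M" and eq: "distr M borel X = distr M borel Y"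
  shows "prob {\<omega>\<in>space M. h < X \<omega>} = prob {\<omega>\<in>space M. h < Y \<omega>}"
proof -
  have "prob {\<omega>\<in>space M. h < Z \<omega>} = measure (distr M borel Z) {h<..}" if "Z \<in> borel_measurable M" for Z
    using that by (subst measure_distr) (auto intro!: arg_cong[where f = prob])
  then show ?thesis using X Y eq by simp
qed

text \<open>Outside the event that \<open>m\<close> renewals happen up to \<open>T\<close> and the events that one of the first \<open>m\<close>
  interarrival times is large, the path is within \<open>e\<close> of zero; the union bound does the rest.\<close>

lemma (in prob_space) prob_recurrence_path_far_le:
  assumes \<tau>: "\<And>n. 1 \<le> n \<Longrightarrow> \<tau> n \<in> borel_measurable M"
    and ident: "\<And>n. 1 \<le> n \<Longrightarrow> distr M borel (\<tau> n) = distr M borel (\<tau> 1)"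
    and pos: "\<And>n \<omega>. 1 \<le> n \<Longrightarrow> \<omega> \<in> space M \<Longrightarrow> 0 < \<tau> n \<omega>"
    and T: "0 < T" and e: "0 < e"
  shows "prob {\<omega>\<in>space M. e < dist (skorokhod_of (scaled_recurrence_path \<tau> p T \<omega>)) (skorokhod_of (\<lambda>v. (0, 0)))}
    \<le> prob {\<omega>\<in>space M. arrival \<tau> m \<omega> \<le> T} + m * prob {\<omega>\<in>space M. e * T powr (1 / p) < \<tau> 1 \<omega>}"
    (is "prob ?F \<le> prob ?L + _")
proof -
  let ?G = "\<lambda>i. {\<omega>\<in>space M. e * T powr (1 / p) < \<tau> i \<omega>}"
  have [measurable]: "arrival \<tau> m \<in> borel_measurable M" by (rule borel_measurable_arrival) (rule \<tau>)
  have L: "?L \<in> events" by measurable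
  have G: "?G i \<in> events" if "i \<in> {1..m}" for i
  proof -
    have [measurable]: "\<tau> i \<in> borel_measurable M" using \<tau> that by simp
    show ?thesis by measurable
  qed
  have large: "prob (?G i) = prob (?G 1)" if "1 \<le> i" for i
    using that by (intro prob_greater_eq_of_distr_eq \<tau> ident) auto
  have GU: "(\<Union>i\<in>{1..m}. ?G i) \<in> events" by (rule sets.finite_UN) (simp, rule G)
  have "?F \<subseteq> ?L \<union> (\<Union>i\<in>{1..m}. ?G i)"
  proof (rule subsetI, rule ccontr)
    fix \<omega>
    assume far: "\<omega> \<in> ?F" and good: "\<omega> \<notin> ?L \<union> (\<Union>i\<in>{1..m}. ?G i)"
    have w: "\<omega> \<in> space M" using far by blast
    have "\<omega> \<notin> ?L" using good by (rule contrapos_nn) (rule UnI1)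
    then have many: "T < arrival \<tau> m \<omega>" using w by simp
    have small: "\<tau> i \<omega> \<le> e * T powr (1 / p)" if "i \<in> {1..m}" for i
    proof -
      have "\<omega> \<notin> ?G i" using good by (rule contrapos_nn) (rule UnI2[OF UN_I[OF that]])
      then show ?thesis using w by simp
    qed
    have "dist (skorokhod_of (scaled_recurrence_path \<tau> p T \<omega>)) (skorokhod_of (\<lambda>v. (0, 0))) \<le> e"
      by (rule dist_scaled_recurrence_path_zero_le[OF pos[OF _ w] T e many small])
    then show False using far by simp
  qed
  then have "prob ?F \<le> prob (?L \<union> (\<Union>i\<in>{1..m}. ?G i))"
    by (rule finite_measure_mono) (rule sets.Un[OF L GU])
  also have "\<dots> \<le> prob ?L + prob (\<Union>i\<in>{1..m}. ?G i)"
    by (rule measure_Un_le[OF L GU])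
  also have "prob (\<Union>i\<in>{1..m}. ?G i) \<le> (\<Sum>i\<in>{1..m}. prob (?G i))"
    by (rule finite_measure_subadditive_finite) (simp, rule image_subsetI, rule G)
  also have "\<dots> = (\<Sum>i\<in>{1..m}. prob (?G 1))" by (rule sum.cong[OF refl large]) simp
  finally show ?thesis by simp
qed

section \<open>The scaled recurrence times vanish\<close>

theorem theorem1p7:
  fixes M :: "'a measure" and \<tau> :: "nat \<Rightarrow> 'a \<Rightarrow> real" and s p :: real
  assumes "prob_space M"
    and "prob_space.indep_vars M (\<lambda>_. borel) \<tau> {1..}"
    and "\<And>n. 1 \<le> n \<Longrightarrow> distr M borel (\<tau> n) = distr M borel (\<tau> 1)"
    and "\<And>n \<omega>. 1 \<le> n \<Longrightarrow> \<omega> \<in> space M \<Longrightarrow> 0 < \<tau> n \<omega>"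
    and "1 \<le> s"
    and "integrable M (\<lambda>\<omega>. \<tau> 1 \<omega> powr s)"
    and "0 < p" and "p \<le> s"
  shows "converges_in_distribution M
           (\<lambda>T \<omega>. skorokhod_of (scaled_recurrence_path \<tau> p T \<omega>))
           (\<lambda>\<omega>. skorokhod_of (\<lambda>v. (0, 0)))
           at_top"
proof -
  interpret prob_space M by fact
  note indep = assms(2) and ident = assms(3) and pos = assms(4)
  have \<tau>: "\<tau> n \<in> borel_measurable M" if "1 \<le> n" for n
    using indep that unfolding indep_vars_def by auto
  define X where "X T \<omega> = skorokhod_of (scaled_recurrence_path \<tau> p T \<omega>)" for T \<omega>
  define Z :: "(real \<times> real) skorokhod" where "Z = skorokhod_of (\<lambda>v. (0, 0))"
  have X_meas: "X T \<in> borel_measurable M" if "0 < T" for T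
    unfolding X_def using that pos
    by (intro borel_measurable_skorokhod_of cadlag_scaled_recurrence_path
        borel_measurable_scaled_recurrence_path \<tau>) auto
  obtain C where C: "0 < C"
    and few: "\<And>m T. C * T \<le> real m \<Longrightarrow> prob {\<omega>\<in>space M. arrival \<tau> m \<omega> \<le> T} \<le> exp (- T)"
    using few_renewals_exponential_bound[OF indep ident pos] by blast
  \<comment> \<open>The number of renewals to inspect: large enough for the Chernoff bound, yet linear in \<open>T\<close>.\<close>
  define m where "m T = nat \<lceil>C * T\<rceil>" for T
  have m: "C * T \<le> m T" "m T \<le> C * T + 1" if "0 < T" for T
    using mult_pos_pos[OF C that] unfolding m_def by linarith+
  have "((\<lambda>T. prob {\<omega>\<in>space M. e < dist (X T \<omega>) Z}) \<longlongrightarrow> 0) at_top" if e: "0 < e" for e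
  proof -
    define tail where "tail T = prob {\<omega>\<in>space M. e powr p * T < \<tau> 1 \<omega> powr p}" for T
    have tail: "((\<lambda>T. T * tail T) \<longlongrightarrow> 0) at_top"
      unfolding tail_def
    proof (rule tail_prob_tendsto_0)
      show "integrable M (\<lambda>\<omega>. \<tau> 1 \<omega> powr p)"
        by (rule integrable_powr_le_exponent[OF \<tau> less_imp_le[OF pos] assms(6-8)]) auto
    qed (use e in auto)
    have bound: "prob {\<omega>\<in>space M. e < dist (X T \<omega>) Z} \<le> exp (- T) + (C + 1) * (T * tail T)"
      if T: "1 \<le> T" for T
    proof -
      \<comment> \<open>The threshold for an interarrival time, whose \<open>p\<close>-th power is linear in \<open>T\<close>.\<close>
      define h where "h = e * T powr (1 / p)"
      have h: "0 < h" using e T by (simp add: h_def)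
      have hp: "h powr p = e powr p * T"
        using e T assms(7) by (simp add: h_def powr_mult powr_powr)
      have "h < y \<longleftrightarrow> e powr p * T < y powr p" if "0 < y" for y
        unfolding hp[symmetric] using h that assms(7) powr_less_mono2[of p h y] powr_mono2[of p y h]
        by (cases "h < y") auto
      then have "{\<omega>\<in>space M. h < \<tau> 1 \<omega>} = {\<omega>\<in>space M. e powr p * T < \<tau> 1 \<omega> powr p}"
        using pos[of 1] by (intro Collect_cong conj_cong refl) simp
      then have "prob {\<omega>\<in>space M. h < \<tau> 1 \<omega>} = tail T" by (simp only: tail_def)
      then have "prob {\<omega>\<in>space M. e < dist (X T \<omega>) Z}
          \<le> prob {\<omega>\<in>space M. arrival \<tau> (m T) \<omega> \<le> T} + m T * tail T"
        using prob_recurrence_path_far_le[where \<tau> = \<tau>, OF \<tau> ident pos, of T e p "m T"] T e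
        by (simp only: X_def Z_def h_def)
      also have "\<dots> \<le> exp (- T) + ((C + 1) * T) * tail T"
      proof (rule add_mono)
        show "prob {\<omega>\<in>space M. arrival \<tau> (m T) \<omega> \<le> T} \<le> exp (- T)"
          by (rule few[OF m(1)]) (use T in simp)
        have "m T \<le> (C + 1) * T" using m(2)[of T] T by (simp add: distrib_right)
        then show "m T * tail T \<le> ((C + 1) * T) * tail T"
          by (rule mult_right_mono) (simp add: tail_def)
      qed
      finally show ?thesis by (simp only: mult.assoc)
    qed
    have "((\<lambda>T::real. exp (- T)) \<longlongrightarrow> 0) at_top"
      by (rule filterlim_compose[OF exp_at_bot filterlim_uminus_at_bot_at_top])
    then have "((\<lambda>T. exp (- T) + (C + 1) * (T * tail T)) \<longlongrightarrow> 0 + (C + 1) * 0) at_top"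
      by (intro tendsto_intros tail)
    then have lim: "((\<lambda>T. exp (- T) + (C + 1) * (T * tail T)) \<longlongrightarrow> 0) at_top" by simp
    have "\<forall>\<^sub>F T::real in at_top. 1 \<le> T" by (rule eventually_ge_at_top)
    then have "\<forall>\<^sub>F T in at_top. prob {\<omega>\<in>space M. e < dist (X T \<omega>) Z} \<le> exp (- T) + (C + 1) * (T * tail T)"
      by eventually_elim (rule bound)
    then show ?thesis
      by (rule tendsto_sandwich[OF always_eventually[OF allI[OF measure_nonneg]] _ tendsto_const lim])
  qed
  moreover have "\<forall>\<^sub>F T in at_top. X T \<in> borel_measurable M"
    using eventually_gt_at_top[of "0::real"] by eventually_elim (rule X_meas)
  ultimately have "converges_in_distribution M X (\<lambda>_. Z) at_top"
    by (rule converges_in_distribution_constI[rotated])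
  then show ?thesis unfolding X_def Z_def .
qed

end
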